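(* There exists a family of simplicial complexes $\{\mathcal{K}_{2r}: r\ge 1\}$, indexed by the integers $r\ge 1$, such that $\operatorname{rank} HH^*(\mathcal{Z}_{\mathcal{K}_{2r}})=2r$ for every $r\ge1$.
   Context: All cohomology is taken with coefficients in $\mathbb{R}$, and rank means dimension over $\mathbb{R}$. A simplicial complex $\mathcal{K}$ is on a finite vertex set $[m]=\{1,\dots,m\}$ and is assumed to satisfy $\varnothing\in\mathcal{K}$ and $\{i\}\in\mathcal{K}$ for all $i\in[m]$. For $I\subset[m]$, $\mathcal{K}_I=\{\sigma\in\mathcal{K}:\sigma\subset I\}$ is the full subcomplex, and $\widetilde{H}^*(\mathcal{K}_I)$ is its reduced simplicial cohomology, with the convention $\widetilde{H}^*(\mathcal{K}_\varnothing)=\widetilde{H}^{-1}(\mathcal{K}_\varnothing)=\mathbb{R}$. The moment-angle complex is $\mathcal{Z}_{\mathcal{K}}=\bigcup_{I\in\mathcal{K}}(D^2,S^1)^I\subset(D^2)^m$, where $(D^2,S^1)^I=\{(z_1,\dots,z_m)\in(D^2)^m: |z_j|=1\text{ if }j\notin I\}$. Its cohomology is $H^*(\mathcal{Z}_{\mathcal{K}})\cong\bigoplus_{I\subset[m]}\widetilde{H}^*(\mathcal{K}_I)$. Double cohomology: for $i\in I\subset[m]$ let $\psi_{p;i,I}:\widetilde{H}^p(\mathcal{K}_I)\to\widetilde{H}^p(\mathcal{K}_{I\setminus\{i\}})$ be induced by inclusion, and set $d'_p=(-1)^{p+1}\sum_{i\in I}\varepsilon(i,I)\,\psi_{p;i,I}:\widetilde{H}^p(\mathcal{K}_I)\to\bigoplus_{i\in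 I}\widetilde{H}^p(\mathcal{K}_{I\setminus\{i\}})$, where $\varepsilon(i,I)=(-1)^{\#\{l\in I:\,l<i\}}$. This defines $d'$ on $\bigoplus_{I\subset[m]}\widetilde{H}^*(\mathcal{K}_I)\cong H^*(\mathcal{Z}_{\mathcal{K}})$ with $(d')^2=0$. The double cohomology is $HH^*(\mathcal{Z}_{\mathcal{K}})=H(H^*(\mathcal{Z}_{\mathcal{K}}),d')=\ker d'/\operatorname{Im}d'$, and $\operatorname{rank}HH^*(\mathcal{Z}_{\mathcal{K}})$ is its total rank. *)

theory Defs
  imports "HOL-Algebra.AbelCoset" "Jordan_Normal_Form.VS_Connect"
begin

section \<open>Quotients and direct sums of vector spaces\<close>

text \<open>Vector spaces are \<open>module\<close> records over \<^term>\<open>class_ring :: real ring\<close>; the ring fields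
  \<open>mult\<close> and \<open>one\<close> of such a record play no role.\<close>

text \<open>Elements of \<open>M / N\<close> are cosets of \<open>N\<close>. Adding \<open>N\<close> to the pointwise multiple
  \<open>a X\<close> matters only for \<open>a = 0\<close>, where \<open>a X = {0}\<close> is not a coset.\<close>

definition quotient_module :: "('a, 'b) module \<Rightarrow> 'b set \<Rightarrow> ('a, 'b set) module" where
  "quotient_module M N =
    \<lparr> carrier = a_rcosets\<^bsub>M\<^esub> N,
      mult = undefined,
      one = undefined,
      zero = N,
      add = (\<lambda>X Y. X <+>\<^bsub>M\<^esub> Y),
      smult = (\<lambda>a X. N <+>\<^bsub>M\<^esub> ((\<lambda>x. a \<odot>\<^bsub>M\<^esub> x) ` X)) \<rparr>"

definition module_sum :: "'i set \<Rightarrow> ('i \<Rightarrow> ('a, 'b) module) \<Rightarrow> ('a, 'i \<Rightarrow> 'b) module" where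
  "module_sum A M =
    \<lparr> carrier = {x \<in> (\<Pi>\<^sub>E i\<in>A. carrier (M i)). finite {i \<in> A. x i \<noteq> \<zero>\<^bsub>M i\<^esub>}},
      mult = undefined,
      one = undefined,
      zero = (\<lambda>i\<in>A. \<zero>\<^bsub>M i\<^esub>),
      add = (\<lambda>x y. \<lambda>i\<in>A. x i \<oplus>\<^bsub>M i\<^esub> y i),
      smult = (\<lambda>a x. \<lambda>i\<in>A. a \<odot>\<^bsub>M i\<^esub> x i) \<rparr>"


section \<open>Simplicial complexes and reduced simplicial cohomology\<close>

definition simplicial_complex_on :: "nat \<Rightarrow> nat set set \<Rightarrow> bool" where
  "simplicial_complex_on m K \<longleftrightarrow>
     K \<subseteq> Pow {1..m} \<and> {} \<in> K \<and> (\<forall>i\<in>{1..m}. {i} \<in> K) \<and>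
     (\<forall>\<sigma>\<in>K. \<forall>\<tau>. \<tau> \<subseteq> \<sigma> \<longrightarrow> \<tau> \<in> K)"

definition full_subcomplex :: "nat set set \<Rightarrow> nat set \<Rightarrow> nat set set" where
  "full_subcomplex K I = {\<sigma> \<in> K. \<sigma> \<subseteq> I}"

definition eps :: "nat \<Rightarrow> nat set \<Rightarrow> real" where
  "eps i I = (- 1) ^ card {l \<in> I. l < i}"

text \<open>Degrees are integers, and the empty simplex has dimension \<open>-1\<close>. Simplices are oriented by
  the order of their vertices, and a \<open>p\<close>-cochain is a function on all sets of vertices that
  vanishes off the \<open>p\<close>-simplices of the complex.\<close>

definition simplices :: "nat set set \<Rightarrow> int \<Rightarrow> nat set set" where
  "simplices K p = {\<sigma> \<in> K. finite \<sigma> \<and> int (card \<sigma>) = p + 1}"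

definition cochains :: "nat set set \<Rightarrow> int \<Rightarrow> (real, nat set \<Rightarrow> real) module" where
  "cochains K p =
    \<lparr> carrier = {f. \<forall>\<sigma>. \<sigma> \<notin> simplices K p \<longrightarrow> f \<sigma> = 0},
      mult = undefined,
      one = undefined,
      zero = (\<lambda>\<sigma>. 0),
      add = (\<lambda>f g \<sigma>. f \<sigma> + g \<sigma>),
      smult = (\<lambda>a f \<sigma>. a * f \<sigma>) \<rparr>"

definition coboundary :: "nat set set \<Rightarrow> int \<Rightarrow> (nat set \<Rightarrow> real) \<Rightarrow> nat set \<Rightarrow> real" where
  "coboundary K p f =
    (\<lambda>\<sigma>. if \<sigma> \<in> simplices K (p + 1) then \<Sum>v\<in>\<sigma>. eps v \<sigma> * f (\<sigma> - {v}) else 0)"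

definition cocycles :: "nat set set \<Rightarrow> int \<Rightarrow> (nat set \<Rightarrow> real) set" where
  "cocycles K p = a_kernel (cochains K p) (cochains K (p + 1)) (coboundary K p)"

definition coboundaries :: "nat set set \<Rightarrow> int \<Rightarrow> (nat set \<Rightarrow> real) set" where
  "coboundaries K p = coboundary K (p - 1) ` carrier (cochains K (p - 1))"

definition reduced_cohomology :: "nat set set \<Rightarrow> int \<Rightarrow> (real, (nat set \<Rightarrow> real) set) module" where
  "reduced_cohomology K p =
    quotient_module (cochains K p\<lparr>carrier := cocycles K p\<rparr>) (coboundaries K p)"

definition restrict_cochain :: "nat set set \<Rightarrow> (nat set \<Rightarrow> real) \<Rightarrow> nat set \<Rightarrow> real" where
  "restrict_cochain L f = (\<lambda>\<sigma>. if \<sigma> \<in> L then f \<sigma> else 0)"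

text \<open>The map \<open>H\<^sup>p(K) \<rightarrow> H\<^sup>p(L)\<close> induced by the inclusion of a subcomplex \<open>L\<close> of \<open>K\<close>; it sends the
  class of \<open>f\<close> to the class of its restriction.\<close>

definition cohomology_restrict ::
    "nat set set \<Rightarrow> int \<Rightarrow> (nat set \<Rightarrow> real) set \<Rightarrow> (nat set \<Rightarrow> real) set" where
  "cohomology_restrict L p X = coboundaries L p <+>\<^bsub>cochains L p\<^esub> (restrict_cochain L ` X)"


section \<open>Double cohomology of moment-angle complexes\<close>

definition moment_angle_index :: "nat \<Rightarrow> (int \<times> nat set) set" where
  "moment_angle_index m = UNIV \<times> Pow {1..m}"

text \<open>\<open>H\<^sup>*(Z\<^sub>K)\<close>, as the sum of all \<open>H\<^sup>p(K\<^sub>I)\<close>.\<close>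

definition moment_angle_cohomology ::
    "nat \<Rightarrow> nat set set \<Rightarrow> (real, int \<times> nat set \<Rightarrow> (nat set \<Rightarrow> real) set) module" where
  "moment_angle_cohomology m K =
    module_sum (moment_angle_index m) (\<lambda>(p, I). reduced_cohomology (full_subcomplex K I) p)"

definition psi ::
    "nat set set \<Rightarrow> int \<Rightarrow> nat \<Rightarrow> nat set \<Rightarrow> (nat set \<Rightarrow> real) set \<Rightarrow> (nat set \<Rightarrow> real) set" where
  "psi K p i I = cohomology_restrict (full_subcomplex K (I - {i})) p"

text \<open>The summand of index \<open>(p, I)\<close> is mapped to the summands of index \<open>(p, I - {i})\<close> with \<open>i \<in> I\<close>,
  by \<open>(-1)\<^bsup>p+1\<^esup> eps i I\<close> times \<open>psi K p i I\<close>. Hence the component of the result at \<open>(p, J)\<close> collects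
  the contributions of the sets \<open>I = J \<union> {i}\<close> with \<open>i \<notin> J\<close>.\<close>

definition double_differential ::
    "nat \<Rightarrow> nat set set \<Rightarrow> (int \<times> nat set \<Rightarrow> (nat set \<Rightarrow> real) set)
      \<Rightarrow> int \<times> nat set \<Rightarrow> (nat set \<Rightarrow> real) set" where
  "double_differential m K x =
    (\<lambda>(p, J)\<in>moment_angle_index m.
       \<Oplus>\<^bsub>reduced_cohomology (full_subcomplex K J) p\<^esub> i\<in>{1..m} - J.
         ((- 1) powi (p + 1) * eps i (insert i J))
           \<odot>\<^bsub>reduced_cohomology (full_subcomplex K J) p\<^esub>
         psi K p i (insert i J) (x (p, insert i J)))"

definition double_cohomology ::
    "nat \<Rightarrow> nat set set \<Rightarrow> (real, (int \<times> nat set \<Rightarrow> (nat set \<Rightarrow> real) set) set) module" where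
  "double_cohomology m K =
    (let H = moment_angle_cohomology m K; d = double_differential m K
     in quotient_module (H\<lparr>carrier := a_kernel H H d\<rparr>) (d ` carrier H))"

definition rank_double_cohomology :: "nat \<Rightarrow> nat set set \<Rightarrow> nat" where
  "rank_double_cohomology m K =
    vectorspace.dim (class_ring :: real ring) (double_cohomology m K)"

end

theory Submission
  imports Defs
begin

text \<open>
  For \<open>r \<ge> 1\<close> take the vertex set \<open>V = {1, \<dots>, 2r + 2}\<close>, the disjoint pairs \<open>{i, r + i}\<close> for
  \<open>1 \<le> i \<le> r\<close>, and let \<open>K\<close> be the complex whose minimal non-faces are the complements
  \<open>F\<^sub>i = V - {i, r + i}\<close> of these pairs. Any two of the \<open>F\<^sub>i\<close> have union \<open>V\<close>, so that the
  Stanley-Reisner ideal of \<open>K\<close> has \<open>r\<close> generators of degree \<open>2r\<close> and \<open>r - 1\<close> syzygies, all of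
  degree \<open>2r + 2\<close>, and nothing else. By Hochster's formula the reduced cohomology of the full
  subcomplexes \<open>K\<^sub>I\<close> is therefore

  \<^item> of rank \<open>1\<close> in degree \<open>-1\<close> for \<open>I = {}\<close>,
  \<^item> of rank \<open>1\<close> in degree \<open>2r - 2\<close> for each \<open>I = F\<^sub>i\<close>, where \<open>K\<^sub>I\<close> is the boundary of a simplex,
  \<^item> of rank \<open>r - 1\<close> in degree \<open>2r - 1\<close> for \<open>I = V\<close>,
  \<^item> zero in all other cases, where \<open>K\<^sub>I\<close> is a cone if \<open>I\<close> is neither empty, nor an \<open>F\<^sub>i\<close>, nor \<open>V\<close>.

  The total rank is \<open>1 + r + (r - 1) = 2r\<close>. Removing one vertex from \<open>I\<close> never leads from one of
  these summands to another: the summands in a fixed degree belong to sets \<open>I\<close> of one fixed size. The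
  pairs have two elements precisely in order to achieve this; with singletons instead, the summands
  \<open>F\<^sub>i\<close> and \<open>V\<close> would lie in the same degree and differ by one vertex. Hence \<open>d' = 0\<close> and the double
  cohomology is all of the cohomology of the moment-angle complex.

  The cohomology groups are computed by hand rather than through resolutions. The tool is the cone
  operator of the full simplex, a contracting homotopy (\<open>cone_homotopy\<close>). It yields
  \<open>coboundary_criterion\<close>: whether a cocycle of \<open>K\<close> is a coboundary is decided by the values of its
  coboundary, taken in the full simplex, on the few non-faces of the form \<open>insert v \<sigma>\<close> with \<open>\<sigma>\<close> a
  face. These values also serve as coordinates on the cohomology. Since all spaces involved are
  iterated quotients and sums, each of them is described by an explicit system of coordinates, and the
  passage of coordinates to quotients and sums (\<open>coordinates_quotient\<close>, \<open>coordinates_module_sum\<close>)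
  carries the computation through to \<open>rank_double_cohomology_sparse\<close>.
\<close>

section \<open>Coordinates on vector spaces\<close>

text \<open>A family of linear forms \<open>\<lambda>x. \<phi> x t\<close>, indexed by \<open>t\<close>. That \<open>V\<close> is a vector space is not
  part of the notion, so that it can be used to prove that quotients and sums are vector spaces;
  closure of the carrier is included for this purpose.\<close>
definition linear_forms :: "(real, 'b) module \<Rightarrow> ('b \<Rightarrow> 't \<Rightarrow> real) \<Rightarrow> bool" where
  "linear_forms V \<phi> \<longleftrightarrow>
     \<zero>\<^bsub>V\<^esub> \<in> carrier V \<and> (\<forall>t. \<phi> \<zero>\<^bsub>V\<^esub> t = 0) \<and>
     (\<forall>x\<in>carrier V. \<forall>y\<in>carrier V. x \<oplus>\<^bsub>V\<^esub> y \<in> carrier V \<and> (\<forall>t. \<phi> (x \<oplus>\<^bsub>V\<^esub> y) t = \<phi> x t + \<phi> y t)) \<and>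
     (\<forall>a. \<forall>x\<in>carrier V. a \<odot>\<^bsub>V\<^esub> x \<in> carrier V \<and> (\<forall>t. \<phi> (a \<odot>\<^bsub>V\<^esub> x) t = a * \<phi> x t))"

definition supported_on :: "'t set \<Rightarrow> ('t \<Rightarrow> real) set" where
  "supported_on T = {c. \<forall>t. t \<notin> T \<longrightarrow> c t = 0}"

text \<open>Functions that vanish off \<open>T\<close> stand for \<open>\<real>\<^sup>T\<close>, so that \<open>\<phi>\<close> is a linear isomorphism of
  \<open>V\<close> with \<open>\<real>\<^sup>T\<close>.\<close>
definition coordinates :: "(real, 'b) module \<Rightarrow> 't set \<Rightarrow> ('b \<Rightarrow> 't \<Rightarrow> real) \<Rightarrow> bool" where
  "coordinates V T \<phi> \<longleftrightarrow> linear_forms V \<phi> \<and> bij_betw \<phi> (carrier V) (supported_on T)"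

lemma linear_formsI:
  assumes "\<zero>\<^bsub>V\<^esub> \<in> carrier V" "\<And>t. \<phi> \<zero>\<^bsub>V\<^esub> t = 0"
    and "\<And>x y. x \<in> carrier V \<Longrightarrow> y \<in> carrier V \<Longrightarrow> x \<oplus>\<^bsub>V\<^esub> y \<in> carrier V"
    and "\<And>x y t. x \<in> carrier V \<Longrightarrow> y \<in> carrier V \<Longrightarrow> \<phi> (x \<oplus>\<^bsub>V\<^esub> y) t = \<phi> x t + \<phi> y t"
    and "\<And>a x. x \<in> carrier V \<Longrightarrow> a \<odot>\<^bsub>V\<^esub> x \<in> carrier V"
    and "\<And>a x t. x \<in> carrier V \<Longrightarrow> \<phi> (a \<odot>\<^bsub>V\<^esub> x) t = a * \<phi> x t"
  shows "linear_forms V \<phi>"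
  using assms by (auto simp: linear_forms_def)

lemma linear_formsD:
  assumes "linear_forms V \<phi>"
  shows "\<zero>\<^bsub>V\<^esub> \<in> carrier V" "\<phi> \<zero>\<^bsub>V\<^esub> = (\<lambda>t. 0)"
    and "x \<in> carrier V \<Longrightarrow> y \<in> carrier V \<Longrightarrow> x \<oplus>\<^bsub>V\<^esub> y \<in> carrier V"
    and "x \<in> carrier V \<Longrightarrow> y \<in> carrier V \<Longrightarrow> \<phi> (x \<oplus>\<^bsub>V\<^esub> y) = (\<lambda>t. \<phi> x t + \<phi> y t)"
    and "x \<in> carrier V \<Longrightarrow> a \<odot>\<^bsub>V\<^esub> x \<in> carrier V"
    and "x \<in> carrier V \<Longrightarrow> \<phi> (a \<odot>\<^bsub>V\<^esub> x) = (\<lambda>t. a * \<phi> x t)"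
  using assms by (auto simp: linear_forms_def)

text \<open>The axioms are equations between vectors, and an injective family of linear forms reduces them
  to equations between real numbers.\<close>
lemma vectorspace_of_injective_forms:
  fixes V :: "(real, 'b) module"
  assumes lin: "linear_forms V \<phi>" and inj: "inj_on \<phi> (carrier V)"
  shows "vectorspace class_ring V"
proof -
  note D = linear_formsD[OF lin]
  note E = inj_onD[OF inj]
  show ?thesis
    by (rule vs_criteria[OF class_field])
      (auto intro!: E D bexI[of _ "(-1) \<odot>\<^bsub>V\<^esub> _"] simp: D algebra_simps)
qed

text \<open>The vectors \<open>u t\<close> whose coordinates are the indicator functions of the points of \<open>T\<close> form a
  basis.\<close>
lemma dim_eq_card_coordinates:
  fixes V :: "(real, 'b) module"
  assumes co: "coordinates V T \<phi>" and fin: "finite T"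
  shows "vectorspace.dim class_ring V = card T"
proof -
  from co have lin: "linear_forms V \<phi>" and bij: "bij_betw \<phi> (carrier V) (supported_on T)"
    by (auto simp: coordinates_def)
  note D = linear_formsD[OF lin]
  have inj: "inj_on \<phi> (carrier V)" using bij by (rule bij_betw_imp_inj_on)
  interpret V: vectorspace "class_ring :: real ring" V
    by (rule vectorspace_of_injective_forms[OF lin inj])
  define u where "u t = inv_into (carrier V) \<phi> (\<lambda>s. if s = t then 1 else 0)" for t
  have u: "u t \<in> carrier V" "\<phi> (u t) = (\<lambda>s. if s = t then 1 else 0)" if "t \<in> T" for t
  proof -
    have *: "(\<lambda>s. if s = t then 1 else 0) \<in> \<phi> ` carrier V"
      using that bij by (auto simp: bij_betw_def supported_on_def)
    show "u t \<in> carrier V" "\<phi> (u t) = (\<lambda>s. if s = t then 1 else 0)"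
      unfolding u_def by (rule inv_into_into[OF *], rule f_inv_into_f[OF *])
  qed
  have inju: "inj_on u T"
  proof (rule inj_onI)
    fix s t assume st: "s \<in> T" "t \<in> T" "u s = u t"
    have "\<phi> (u s) s = \<phi> (u t) s" using st by simp
    then show "s = t" by (simp add: u(2)[OF st(1)] u(2)[OF st(2)] split: if_splits)
  qed
  define B where "B = u ` T"
  have finB: "finite B" and BV: "B \<subseteq> carrier V" and cardB: "card B = card T"
    using fin u inju by (auto simp: B_def card_image)
  have comb: "\<phi> (V.lincomb a A) = (\<lambda>t. \<Sum>w\<in>A. a w * \<phi> w t)" if "finite A" "A \<subseteq> carrier V" for a A
    using that
  proof (induction A rule: finite_induct)
    case empty
    then show ?case by (simp add: V.lincomb_def D)
  next
    case (insert w A)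
    have "V.lincomb a (insert w A) = a w \<odot>\<^bsub>V\<^esub> w \<oplus>\<^bsub>V\<^esub> V.lincomb a A"
      unfolding V.lincomb_def using insert by (subst V.finsum_insert) (auto intro: D)
    moreover have "V.lincomb a A \<in> carrier V" using insert by auto
    ultimately show ?case using insert by (simp add: D)
  qed
  have combB: "\<phi> (V.lincomb a B) = (\<lambda>t. if t \<in> T then a (u t) else 0)" for a
  proof
    fix t
    have "\<phi> (V.lincomb a B) t = (\<Sum>s\<in>T. a (u s) * \<phi> (u s) t)"
      using comb[OF finB BV] inju by (simp add: B_def sum.reindex)
    also have "\<dots> = (\<Sum>s\<in>T. if s = t then a (u t) else 0)"
      by (rule sum.cong) (auto simp: u)
    also have "\<dots> = (if t \<in> T then a (u t) else 0)" using fin by simp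
    finally show "\<phi> (V.lincomb a B) t = (if t \<in> T then a (u t) else 0)" .
  qed
  have "V.basis B"
    unfolding V.basis_criterion[OF finB BV]
  proof (intro allI impI)
    fix v assume v: "v \<in> carrier V"
    have eq: "V.lincomb a B = v \<longleftrightarrow> (\<forall>t\<in>T. a (u t) = \<phi> v t)" for a
    proof -
      have "V.lincomb a B = v \<longleftrightarrow> \<phi> (V.lincomb a B) = \<phi> v"
        using inj_on_eq_iff[OF inj _ v] BV by simp
      moreover have "\<phi> v t = 0" if "t \<notin> T" for t
        using bij v that by (auto simp: bij_betw_def supported_on_def)
      ultimately show ?thesis by (auto simp: combB fun_eq_iff)
    qed
    define b where "b = (\<lambda>w\<in>B. \<phi> v (the_inv_into T u w))"
    have b: "b (u t) = \<phi> v t" if "t \<in> T" for t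
      using that inju by (simp add: b_def B_def the_inv_into_f_f)
    show "\<exists>!a. a \<in> B \<rightarrow>\<^sub>E carrier class_ring \<and> V.lincomb a B = v"
    proof (rule ex1I[of _ b])
      show "b \<in> B \<rightarrow>\<^sub>E carrier class_ring \<and> V.lincomb b B = v"
        by (auto simp: eq b) (auto simp: b_def)
      fix a assume a: "a \<in> B \<rightarrow>\<^sub>E carrier class_ring \<and> V.lincomb a B = v"
      show "a = b"
      proof (rule extensionalityI)
        show "a \<in> extensional B" "b \<in> extensional B" using a by (auto simp: b_def PiE_def)
        fix w assume "w \<in> B"
        then obtain t where "t \<in> T" "w = u t" by (auto simp: B_def)
        then show "a w = b w" using a b by (simp add: eq)
      qed
    qed
  qed
  then show ?thesis using V.dim_basis[OF finB] cardB by simp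
qed

text \<open>The cosets of the common kernel of a family of linear forms are its fibres. Through this, all
  operations of the quotient become operations on values of \<open>\<phi>\<close>.\<close>
lemma coset_kernel:
  fixes M :: "(real, 'b) module"
  assumes vs: "vectorspace class_ring M" and lin: "linear_forms M \<phi>"
    and N: "N = {x \<in> carrier M. \<phi> x = (\<lambda>t. 0)}" and x: "x \<in> carrier M"
  shows "N +>\<^bsub>M\<^esub> x = {y \<in> carrier M. \<phi> y = \<phi> x}"
proof -
  interpret M: vectorspace "class_ring :: real ring" M by (rule vs)
  note D = linear_formsD[OF lin]
  show ?thesis
  proof (intro equalityI subsetI)
    fix y assume "y \<in> N +>\<^bsub>M\<^esub> x"
    then show "y \<in> {y \<in> carrier M. \<phi> y = \<phi> x}"
      using x by (auto simp: a_r_coset_def' N D)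
  next
    fix y assume y: "y \<in> {y \<in> carrier M. \<phi> y = \<phi> x}"
    have z: "(-1) \<odot>\<^bsub>M\<^esub> x \<in> carrier M" using x by (rule D)
    have "(-1) \<odot>\<^bsub>M\<^esub> x \<oplus>\<^bsub>M\<^esub> x = ((-1) + 1) \<odot>\<^bsub>M\<^esub> x"
      using M.smult_l_distr[of "-1" 1 x] M.smult_one[OF x] x by simp
    also have "\<dots> = \<zero>\<^bsub>M\<^esub>" using M.smult_l_null[OF x] by simp
    finally have "y = (y \<oplus>\<^bsub>M\<^esub> (-1) \<odot>\<^bsub>M\<^esub> x) \<oplus>\<^bsub>M\<^esub> x"
      using x y z by (simp add: M.a_assoc)
    moreover have "y \<oplus>\<^bsub>M\<^esub> (-1) \<odot>\<^bsub>M\<^esub> x \<in> N"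
      using x y z by (auto simp: N D)
    ultimately show "y \<in> N +>\<^bsub>M\<^esub> x" by (auto simp: a_r_coset_def')
  qed
qed

text \<open>Linear forms on \<open>M\<close> with common kernel \<open>N\<close> are constant on the cosets of \<open>N\<close> and so descend to
  the quotient, where they become injective. The choice of the representative in the coset is
  immaterial.\<close>
lemma coordinates_quotient:
  fixes M :: "(real, 'b) module" and \<phi> :: "'b \<Rightarrow> 't \<Rightarrow> real"
  assumes vs: "vectorspace class_ring M" and lin: "linear_forms M \<phi>"
    and im: "\<phi> ` carrier M = supported_on T"
    and N: "N = {x \<in> carrier M. \<phi> x = (\<lambda>t. 0)}"
  shows "coordinates (quotient_module M N) T (\<lambda>X. \<phi> (SOME x. x \<in> X))"
proof -
  interpret M: vectorspace "class_ring :: real ring" M by (rule vs)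
  note D = linear_formsD[OF lin]
  \<comment> \<open>The elements of the quotient are the fibres of \<open>\<phi>\<close>, indexed by their values.\<close>
  define fib where "fib c = {y \<in> carrier M. \<phi> y = c}" for c
  let ?Q = "quotient_module M N" and ?\<Phi> = "\<lambda>X. \<phi> (SOME x. x \<in> X)"
  have ne: "\<exists>x \<in> carrier M. \<phi> x = c" if "c \<in> supported_on T" for c using im that by (metis imageE)
  have car: "carrier ?Q = fib ` supported_on T"
  proof -
    have "carrier ?Q = (\<lambda>x. fib (\<phi> x)) ` carrier M"
      by (auto simp: quotient_module_def A_RCOSETS_def' coset_kernel[OF vs lin N] fib_def)
    then show ?thesis using im by (metis image_image)
  qed
  have \<Phi>: "?\<Phi> (fib c) = c" if c: "c \<in> supported_on T" for c
  proof -
    have "(SOME x. x \<in> fib c) \<in> fib c" using ne[OF c] by (metis (mono_tags, lifting) fib_def mem_Collect_eq someI)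
    then show ?thesis by (simp add: fib_def)
  qed
  have zero: "\<zero>\<^bsub>?Q\<^esub> = fib (\<lambda>t. 0)" by (simp add: quotient_module_def fib_def N)
  have add: "fib c \<oplus>\<^bsub>?Q\<^esub> fib d = fib (\<lambda>t. c t + d t)"
    if cd: "c \<in> supported_on T" "d \<in> supported_on T" for c d
  proof -
    obtain x y where xy: "x \<in> carrier M" "y \<in> carrier M" "\<phi> x = c" "\<phi> y = d" using ne[OF cd(1)] ne[OF cd(2)] by blast
    have "fib c \<oplus>\<^bsub>?Q\<^esub> fib d = (\<Union>x'\<in>fib c. \<Union>y'\<in>fib d. {x' \<oplus>\<^bsub>M\<^esub> y'})"
      by (simp add: quotient_module_def set_add_def')
    also have "\<dots> = fib (\<lambda>t. c t + d t)"
    proof (intro equalityI subsetI)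
      fix z assume "z \<in> (\<Union>x'\<in>fib c. \<Union>y'\<in>fib d. {x' \<oplus>\<^bsub>M\<^esub> y'})"
      then show "z \<in> fib (\<lambda>t. c t + d t)" by (auto simp: fib_def D)
    next
      fix z assume z: "z \<in> fib (\<lambda>t. c t + d t)"
      have "z \<in> N +>\<^bsub>M\<^esub> (x \<oplus>\<^bsub>M\<^esub> y)"
        using z xy by (auto simp: coset_kernel[OF vs lin N] D fib_def)
      then obtain n where n: "n \<in> N" "z = n \<oplus>\<^bsub>M\<^esub> (x \<oplus>\<^bsub>M\<^esub> y)" by (auto simp: a_r_coset_def')
      then have "z = (n \<oplus>\<^bsub>M\<^esub> x) \<oplus>\<^bsub>M\<^esub> y" using xy by (simp add: M.a_assoc N)
      moreover have "n \<oplus>\<^bsub>M\<^esub> x \<in> fib c" using n xy by (auto simp: N fib_def D)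
      ultimately show "z \<in> (\<Union>x'\<in>fib c. \<Union>y'\<in>fib d. {x' \<oplus>\<^bsub>M\<^esub> y'})"
        using xy by (auto simp: fib_def)
    qed
    finally show ?thesis .
  qed
  have smult: "a \<odot>\<^bsub>?Q\<^esub> fib c = fib (\<lambda>t. a * c t)" if c: "c \<in> supported_on T" for a c
  proof -
    obtain x where x: "x \<in> carrier M" "\<phi> x = c" using ne[OF c] by blast
    have "a \<odot>\<^bsub>?Q\<^esub> fib c = (\<Union>n\<in>N. \<Union>x'\<in>fib c. {n \<oplus>\<^bsub>M\<^esub> a \<odot>\<^bsub>M\<^esub> x'})"
      by (simp add: quotient_module_def set_add_def')
    also have "\<dots> = fib (\<lambda>t. a * c t)"
    proof (intro equalityI subsetI)
      fix z assume "z \<in> (\<Union>n\<in>N. \<Union>x'\<in>fib c. {n \<oplus>\<^bsub>M\<^esub> a \<odot>\<^bsub>M\<^esub> x'})"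
      then show "z \<in> fib (\<lambda>t. a * c t)" by (auto simp: fib_def D N)
    next
      fix z assume z: "z \<in> fib (\<lambda>t. a * c t)"
      have "z \<in> N +>\<^bsub>M\<^esub> (a \<odot>\<^bsub>M\<^esub> x)"
        using z x by (auto simp: coset_kernel[OF vs lin N] D fib_def)
      then show "z \<in> (\<Union>n\<in>N. \<Union>x'\<in>fib c. {n \<oplus>\<^bsub>M\<^esub> a \<odot>\<^bsub>M\<^esub> x'})"
        using x by (auto simp: fib_def a_r_coset_def')
    qed
    finally show ?thesis .
  qed
  have S: "(\<lambda>t. 0) \<in> supported_on T"
    "\<And>c d. c \<in> supported_on T \<Longrightarrow> d \<in> supported_on T \<Longrightarrow> (\<lambda>t. c t + d t) \<in> supported_on T"
    "\<And>a c. c \<in> supported_on T \<Longrightarrow> (\<lambda>t. a * c t) \<in> supported_on T"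
    by (auto simp: supported_on_def)
  have "linear_forms ?Q ?\<Phi>"
    by (rule linear_formsI) (auto simp: car zero add smult \<Phi> S)
  moreover have "bij_betw ?\<Phi> (carrier ?Q) (supported_on T)"
    by (rule bij_betwI[where g = fib]) (auto simp: car \<Phi>)
  ultimately show ?thesis by (simp add: coordinates_def)
qed

text \<open>Finiteness of the total index set forces all but finitely many summands to be zero, which makes
  the finite support condition in the direct sum automatic.\<close>
lemma coordinates_module_sum:
  fixes M :: "'i \<Rightarrow> (real, 'b) module" and T :: "'i \<Rightarrow> 't set"
  assumes co: "\<And>i. i \<in> A \<Longrightarrow> coordinates (M i) (T i) (\<phi> i)"
    and fin: "finite (Sigma A T)"
  shows "coordinates (module_sum A M) (Sigma A T) (\<lambda>x (i, t). if i \<in> A then \<phi> i (x i) t else 0)"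
    (is "coordinates ?S _ ?\<Phi>")
proof -
  have lin: "linear_forms (M i) (\<phi> i)" and bij: "bij_betw (\<phi> i) (carrier (M i)) (supported_on (T i))"
    if "i \<in> A" for i
    using co[OF that] by (auto simp: coordinates_def)
  note D = linear_formsD[OF lin]
  have z: "\<phi> i x = (\<lambda>t. 0) \<longleftrightarrow> x = \<zero>\<^bsub>M i\<^esub>" if "i \<in> A" "x \<in> carrier (M i)" for i x
    using inj_on_eq_iff[OF bij_betw_imp_inj_on[OF bij] that(2) D(1)] that D(2) by metis
  have van: "\<phi> i x t = 0" if "i \<in> A" "x \<in> carrier (M i)" "t \<notin> T i" for i x t
    using bij[OF that(1)] that by (auto simp: bij_betw_def supported_on_def)
  have finz: "finite {i \<in> A. x i \<noteq> \<zero>\<^bsub>M i\<^esub>}" if "x \<in> (\<Pi>\<^sub>E i\<in>A. carrier (M i))" for x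
  proof (rule finite_subset)
    show "finite (fst ` Sigma A T)" using fin by simp
    show "{i \<in> A. x i \<noteq> \<zero>\<^bsub>M i\<^esub>} \<subseteq> fst ` Sigma A T"
    proof
      fix i assume i: "i \<in> {i \<in> A. x i \<noteq> \<zero>\<^bsub>M i\<^esub>}"
      then have xi: "x i \<in> carrier (M i)" using that by auto
      then have "\<phi> i (x i) \<noteq> (\<lambda>t. 0)" using i z by auto
      then obtain t where "\<phi> i (x i) t \<noteq> 0" by auto
      then have "t \<in> T i" using van i xi by blast
      then show "i \<in> fst ` Sigma A T" using i by force
    qed
  qed
  have car: "carrier ?S = (\<Pi>\<^sub>E i\<in>A. carrier (M i))"
    using finz by (auto simp: module_sum_def)
  have "linear_forms ?S ?\<Phi>"
    by (rule linear_formsI, unfold car) (auto simp: module_sum_def D PiE_iff split: prod.splits)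
  moreover have "bij_betw ?\<Phi> (carrier ?S) (supported_on (Sigma A T))"
    unfolding bij_betw_def
  proof (intro conjI inj_onI equalityI subsetI)
    fix x y assume xy: "x \<in> carrier ?S" "y \<in> carrier ?S" "?\<Phi> x = ?\<Phi> y"
    show "x = y"
    proof (rule PiE_ext)
      show "x \<in> (\<Pi>\<^sub>E i\<in>A. carrier (M i))" "y \<in> (\<Pi>\<^sub>E i\<in>A. carrier (M i))" using xy car by auto
      fix i assume i: "i \<in> A"
      have "\<phi> i (x i) = \<phi> i (y i)"
      proof
        fix t show "\<phi> i (x i) t = \<phi> i (y i) t" using fun_cong[OF xy(3), of "(i, t)"] i by simp
      qed
      then show "x i = y i"
        using inj_onD[OF bij_betw_imp_inj_on[OF bij[OF i]]] xy i car by auto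
    qed
  next
    fix c assume "c \<in> ?\<Phi> ` carrier ?S"
    then show "c \<in> supported_on (Sigma A T)" unfolding car
      by (auto simp: supported_on_def PiE_iff intro!: van)
  next
    fix c assume c: "c \<in> supported_on (Sigma A T)"
    define x where "x = (\<lambda>i\<in>A. inv_into (carrier (M i)) (\<phi> i) (\<lambda>t. c (i, t)))"
    have *: "(\<lambda>t. c (i, t)) \<in> \<phi> i ` carrier (M i)" if "i \<in> A" for i
      using bij[OF that] c by (auto simp: bij_betw_def supported_on_def)
    have "x \<in> carrier ?S" unfolding car x_def using * by (auto intro: inv_into_into)
    moreover have "?\<Phi> x = c"
    proof
      fix it show "?\<Phi> x it = c it"
        using c f_inv_into_f[OF *] by (cases it) (auto simp: x_def supported_on_def)
    qed
    ultimately show "c \<in> ?\<Phi> ` carrier ?S" by blast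
  qed
  ultimately show ?thesis by (simp add: coordinates_def)
qed

section \<open>Cochains of the full simplex\<close>

text \<open>The coboundary in the simplex on all vertices. It is evaluated also on sets that are not
  simplices of the complex on which a cochain lives: there it measures the obstruction to extending
  a cocycle to the full simplex.\<close>
definition face_sum :: "(nat set \<Rightarrow> real) \<Rightarrow> nat set \<Rightarrow> real" where
  "face_sum f \<sigma> = (\<Sum>v\<in>\<sigma>. eps v \<sigma> * f (\<sigma> - {v}))"

definition cone :: "nat \<Rightarrow> (nat set \<Rightarrow> real) \<Rightarrow> nat set \<Rightarrow> real" where
  "cone v g \<tau> = (if v \<in> \<tau> then 0 else eps v (insert v \<tau>) * g (insert v \<tau>))"

lemma eps_square: "eps v S * eps v S = 1"
  by (simp add: eps_def flip: power_add mult_2)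

lemma eps_nonzero: "eps v S \<noteq> 0"
  by (simp add: eps_def)

lemma eps_delete:
  assumes "finite S" "u \<in> S" "u \<noteq> v"
  shows "eps v (S - {u}) = (if u < v then - eps v S else eps v S)"
proof (cases "u < v")
  case True
  have "{l \<in> S. l < v} = insert u {l \<in> S - {u}. l < v}" using assms True by auto
  then have "card {l \<in> S. l < v} = Suc (card {l \<in> S - {u}. l < v})"
    using assms by (simp add: card_insert_if)
  then show ?thesis using True by (simp add: eps_def)
next
  case False
  then have "{l \<in> S - {u}. l < v} = {l \<in> S. l < v}" by auto
  then show ?thesis using False by (simp add: eps_def)
qed

text \<open>Deleting two vertices in either order gives opposite signs; this is what makes the coboundary
  square to zero and the cone operator a homotopy.\<close>
lemma eps_swap:
  assumes "finite S" "u \<in> S" "v \<in> S" "u \<noteq> v"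
  shows "eps u S * eps v (S - {u}) = - (eps v S * eps u (S - {v}))"
  using assms by (auto simp: eps_delete)

lemma eps_swap':
  assumes "finite S" "u \<in> S" "v \<in> S" "u \<noteq> v"
  shows "eps u (S - {v}) * eps v (S - {u}) = - (eps v S * eps u S)"
  using assms by (auto simp: eps_delete)

lemma face_sum_linear:
  "face_sum (\<lambda>\<sigma>. f \<sigma> + g \<sigma>) = (\<lambda>\<sigma>. face_sum f \<sigma> + face_sum g \<sigma>)"
  "face_sum (\<lambda>\<sigma>. f \<sigma> - g \<sigma>) = (\<lambda>\<sigma>. face_sum f \<sigma> - face_sum g \<sigma>)"
  "face_sum (\<lambda>\<sigma>. a * f \<sigma>) = (\<lambda>\<sigma>. a * face_sum f \<sigma>)"
  by (auto simp: face_sum_def fun_eq_iff algebra_simps sum.distrib sum_subtractf sum_distrib_left)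

lemma face_sum_zero: "face_sum (\<lambda>\<sigma>. 0) = (\<lambda>\<sigma>. 0)"
  by (simp add: face_sum_def fun_eq_iff)

lemma face_sum_cong:
  assumes "\<And>v. v \<in> \<sigma> \<Longrightarrow> f (\<sigma> - {v}) = g (\<sigma> - {v})"
  shows "face_sum f \<sigma> = face_sum g \<sigma>"
  using assms by (simp add: face_sum_def)

text \<open>The terms of the double sum cancel in pairs, by exchanging the two deleted vertices.\<close>
lemma face_sum_face_sum:
  assumes "finite S"
  shows "face_sum (face_sum f) S = 0"
proof -
  define a where "a u v = (if u = v then 0 else eps u S * eps v (S - {u}) * f (S - {u} - {v}))" for u v
  have anti: "a u v = - a v u" if "u \<in> S" "v \<in> S" for u v
    using eps_swap[OF assms that] by (auto simp: a_def Diff_insert2[symmetric] insert_commute)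
  have "face_sum (face_sum f) S = (\<Sum>u\<in>S. \<Sum>v\<in>S - {u}. a u v)"
    by (auto simp: face_sum_def a_def sum_distrib_left mult.assoc intro!: sum.cong)
  also have "\<dots> = (\<Sum>u\<in>S. \<Sum>v\<in>S. a u v)"
    using assms by (intro sum.cong sum.mono_neutral_left) (auto simp: a_def)
  finally have eq: "face_sum (face_sum f) S = (\<Sum>u\<in>S. \<Sum>v\<in>S. a u v)" .
  also have "\<dots> = (\<Sum>v\<in>S. \<Sum>u\<in>S. a u v)" by (rule sum.swap)
  also have "\<dots> = (\<Sum>v\<in>S. \<Sum>u\<in>S. - a v u)" by (intro sum.cong refl anti)
  also have "\<dots> = - (\<Sum>u\<in>S. \<Sum>v\<in>S. a u v)" by (simp add: sum_negf)
  finally show ?thesis using eq by simp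
qed

text \<open>The simplex is a cone with apex \<open>v\<close>, and \<open>cone v\<close> is the corresponding contracting homotopy. For
  \<open>v \<in> \<sigma>\<close> only the face opposite to \<open>v\<close> contributes; for \<open>v \<notin> \<sigma>\<close> the faces other than \<open>\<sigma>\<close> occur
  in both summands, with opposite signs by \<open>eps_swap'\<close>.\<close>
lemma cone_homotopy:
  assumes "finite \<sigma>"
  shows "face_sum (cone v g) \<sigma> + cone v (face_sum g) \<sigma> = g \<sigma>"
proof (cases "v \<in> \<sigma>")
  case True
  have "face_sum (cone v g) \<sigma> = (\<Sum>u\<in>\<sigma>. if u = v then g \<sigma> else 0)"
    unfolding face_sum_def
  proof (rule sum.cong[OF refl])
    fix u assume "u \<in> \<sigma>"
    then show "eps u \<sigma> * cone v g (\<sigma> - {u}) = (if u = v then g \<sigma> else 0)"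
      using True eps_square[of v \<sigma>] by (auto simp: cone_def insert_absorb mult.assoc[symmetric])
  qed
  then show ?thesis using True assms by (simp add: cone_def)
next
  case False
  define S where "S = insert v \<sigma>"
  have S: "finite S" "v \<in> S" "\<sigma> = S - {v}" using False assms by (auto simp: S_def)
  have "face_sum (cone v g) \<sigma> = (\<Sum>u\<in>\<sigma>. - (eps v S * eps u S * g (S - {u})))"
    unfolding face_sum_def
  proof (rule sum.cong[OF refl])
    fix u assume u: "u \<in> \<sigma>"
    have "insert v (\<sigma> - {u}) = S - {u}" using u False by (auto simp: S_def)
    then have "eps u \<sigma> * cone v g (\<sigma> - {u}) = (eps u (S - {v}) * eps v (S - {u})) * g (S - {u})"
      using False S by (simp add: cone_def)
    moreover have "eps u (S - {v}) * eps v (S - {u}) = - (eps v S * eps u S)"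
      using eps_swap'[of S u v] S u by auto
    ultimately show "eps u \<sigma> * cone v g (\<sigma> - {u}) = - (eps v S * eps u S * g (S - {u}))"
      by simp
  qed
  then have "face_sum (cone v g) \<sigma> = - (eps v S * (\<Sum>u\<in>\<sigma>. eps u S * g (S - {u})))"
    by (simp add: sum_negf sum_distrib_left mult.assoc)
  moreover have "cone v (face_sum g) \<sigma> = eps v S * (eps v S * g \<sigma> + (\<Sum>u\<in>\<sigma>. eps u S * g (S - {u})))"
    using False assms by (simp add: cone_def face_sum_def S_def)
  moreover have "eps v S * (eps v S * g \<sigma>) = g \<sigma>"
    using eps_square[of v S] by (simp flip: mult.assoc)
  ultimately show ?thesis by (simp add: distrib_left)
qed

section \<open>Cocycles, coboundaries and restriction\<close>

definition down_closed :: "'a set set \<Rightarrow> bool" where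
  "down_closed L \<longleftrightarrow> (\<forall>\<sigma>\<in>L. \<forall>\<tau>. \<tau> \<subseteq> \<sigma> \<longrightarrow> \<tau> \<in> L)"

lemma facet_in_simplices:
  assumes "down_closed L" "\<sigma> \<in> simplices L p" "v \<in> \<sigma>"
  shows "\<sigma> - {v} \<in> simplices L (p - 1)"
proof -
  have "\<sigma> - {v} \<in> L" using assms unfolding down_closed_def simplices_def by blast
  moreover have "card \<sigma> = Suc (card (\<sigma> - {v}))"
    using assms by (metis (no_types, lifting) card_Suc_Diff1 mem_Collect_eq simplices_def)
  ultimately show ?thesis using assms(2) by (simp add: simplices_def)
qed

lemma cocycles_iff:
  "f \<in> cocycles L p \<longleftrightarrow>
     (\<forall>\<sigma>. \<sigma> \<notin> simplices L p \<longrightarrow> f \<sigma> = 0) \<and> (\<forall>\<sigma>\<in>simplices L (p + 1). face_sum f \<sigma> = 0)"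
  by (auto simp: cocycles_def a_kernel_def' cochains_def coboundary_def face_sum_def fun_eq_iff)

text \<open>The primitive \<open>h\<close> may be an arbitrary function on sets of vertices, because only its values on
  faces of simplices of \<open>L\<close> matter.\<close>
lemma coboundaries_iff:
  assumes "down_closed L"
  shows "f \<in> coboundaries L p \<longleftrightarrow> (\<exists>h. f = (\<lambda>\<sigma>. if \<sigma> \<in> simplices L p then face_sum h \<sigma> else 0))"
proof
  assume "f \<in> coboundaries L p"
  then obtain h where "f = coboundary L (p - 1) h" by (auto simp: coboundaries_def)
  then have "f = (\<lambda>\<sigma>. if \<sigma> \<in> simplices L p then face_sum h \<sigma> else 0)"
    by (simp add: coboundary_def face_sum_def fun_eq_iff)
  then show "\<exists>h. f = (\<lambda>\<sigma>. if \<sigma> \<in> simplices L p then face_sum h \<sigma> else 0)" by blast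
next
  assume "\<exists>h. f = (\<lambda>\<sigma>. if \<sigma> \<in> simplices L p then face_sum h \<sigma> else 0)"
  then obtain h where h: "f = (\<lambda>\<sigma>. if \<sigma> \<in> simplices L p then face_sum h \<sigma> else 0)" by blast
  define h' where "h' = restrict_cochain (simplices L (p - 1)) h"
  have "face_sum h \<sigma> = face_sum h' \<sigma>" if "\<sigma> \<in> simplices L p" for \<sigma>
    by (rule face_sum_cong) (simp add: h'_def restrict_cochain_def facet_in_simplices[OF assms that])
  then have "f = coboundary L (p - 1) h'"
    by (auto simp: h coboundary_def face_sum_def)
  moreover have "h' \<in> carrier (cochains L (p - 1))"
    by (auto simp: h'_def restrict_cochain_def cochains_def)
  ultimately show "f \<in> coboundaries L p" by (simp add: coboundaries_def)
qed

lemma face_sum_coboundary: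
  assumes "down_closed L" "f \<in> coboundaries L p" "finite S"
    and "\<And>v. v \<in> S \<Longrightarrow> S - {v} \<in> simplices L p"
  shows "face_sum f S = 0"
proof -
  obtain h where h: "f = (\<lambda>\<sigma>. if \<sigma> \<in> simplices L p then face_sum h \<sigma> else 0)"
    using assms coboundaries_iff by blast
  have "face_sum f S = face_sum (face_sum h) S"
    by (rule face_sum_cong) (simp add: h assms)
  then show ?thesis using face_sum_face_sum[OF \<open>finite S\<close>] by simp
qed

lemma coboundaries_subset_cocycles:
  assumes "down_closed L"
  shows "coboundaries L p \<subseteq> cocycles L p"
proof
  fix f assume f: "f \<in> coboundaries L p"
  have "face_sum f \<sigma> = 0" if "\<sigma> \<in> simplices L (p + 1)" for \<sigma>
    using facet_in_simplices[OF assms that] that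
    by (intro face_sum_coboundary[OF assms f]) (auto simp: simplices_def)
  moreover have "f \<sigma> = 0" if "\<sigma> \<notin> simplices L p" for \<sigma>
    using f that by (auto simp: coboundaries_iff[OF assms])
  ultimately show "f \<in> cocycles L p" by (simp add: cocycles_iff)
qed

text \<open>If \<open>f - e\<close> has vanishing coboundary on the sets \<open>insert v \<sigma>\<close>, then the homotopy shows that
  \<open>cone v (f - e)\<close> is a primitive of \<open>f - e\<close> on the simplices of \<open>L\<close>, where \<open>e\<close> vanishes. The
  correction \<open>e\<close>, living on non-faces, is the freedom in extending \<open>f\<close> beyond \<open>L\<close>. For a
  cocycle \<open>f\<close> the last hypothesis is an obstruction only where \<open>insert v \<sigma>\<close> is not a face.\<close>
lemma coboundary_criterion:
  assumes L: "down_closed L"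
    and f: "\<And>\<sigma>. \<sigma> \<notin> simplices L p \<Longrightarrow> f \<sigma> = 0"
    and e: "\<And>\<sigma>. \<sigma> \<in> simplices L p \<Longrightarrow> e \<sigma> = 0"
    and v: "\<And>\<sigma>. \<sigma> \<in> simplices L p \<Longrightarrow> v \<notin> \<sigma> \<Longrightarrow>
              face_sum f (insert v \<sigma>) = face_sum e (insert v \<sigma>)"
  shows "f \<in> coboundaries L p"
  unfolding coboundaries_iff[OF L]
proof (intro exI ext)
  fix \<sigma>
  let ?h = "cone v (\<lambda>\<sigma>. f \<sigma> - e \<sigma>)"
  show "f \<sigma> = (if \<sigma> \<in> simplices L p then face_sum ?h \<sigma> else 0)"
  proof (cases "\<sigma> \<in> simplices L p")
    case True
    then have "cone v (face_sum (\<lambda>\<sigma>. f \<sigma> - e \<sigma>)) \<sigma> = 0"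
      by (simp add: cone_def face_sum_linear v)
    then show ?thesis
      using cone_homotopy[of \<sigma> v "\<lambda>\<sigma>. f \<sigma> - e \<sigma>"] True e[OF True] by (simp add: simplices_def)
  qed (simp add: f)
qed

text \<open>Coordinates on cohomology are linear forms on cochains that separate cocycles exactly up to
  coboundaries.\<close>
lemma coordinates_reduced_cohomology:
  fixes \<phi> :: "(nat set \<Rightarrow> real) \<Rightarrow> 't \<Rightarrow> real"
  assumes L: "down_closed L"
    and add: "\<And>f g t. \<phi> (\<lambda>\<sigma>. f \<sigma> + g \<sigma>) t = \<phi> f t + \<phi> g t"
    and smult: "\<And>a f t. \<phi> (\<lambda>\<sigma>. a * f \<sigma>) t = a * \<phi> f t"
    and supp: "\<And>f t. f \<in> cocycles L p \<Longrightarrow> t \<notin> T \<Longrightarrow> \<phi> f t = 0"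
    and surj: "\<And>c. c \<in> supported_on T \<Longrightarrow> \<exists>f\<in>cocycles L p. \<phi> f = c"
    and ker: "\<And>f. f \<in> cocycles L p \<Longrightarrow> \<phi> f = (\<lambda>t. 0) \<longleftrightarrow> f \<in> coboundaries L p"
  shows "\<exists>\<Phi>. coordinates (reduced_cohomology L p) T \<Phi>"
proof -
  let ?M = "cochains L p\<lparr>carrier := cocycles L p\<rparr>"
  have ops: "(\<lambda>\<sigma>. 0) \<in> cocycles L p"
    "\<And>f g. f \<in> cocycles L p \<Longrightarrow> g \<in> cocycles L p \<Longrightarrow> (\<lambda>\<sigma>. f \<sigma> + g \<sigma>) \<in> cocycles L p"
    "\<And>a f. f \<in> cocycles L p \<Longrightarrow> (\<lambda>\<sigma>. a * f \<sigma>) \<in> cocycles L p"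
    by (auto simp: cocycles_iff face_sum_linear face_sum_zero)
  have "linear_forms ?M (\<lambda>f. f)"
    by (rule linear_formsI) (simp_all add: cochains_def ops)
  then have vs: "vectorspace class_ring ?M"
    by (rule vectorspace_of_injective_forms) (simp add: inj_on_def)
  have lin: "linear_forms ?M \<phi>"
  proof (rule linear_formsI)
    show "\<phi> \<zero>\<^bsub>?M\<^esub> t = 0" for t
      using smult[of 0 "\<lambda>_. 0" t] by (simp add: cochains_def)
  qed (simp_all add: cochains_def ops add smult)
  have "\<phi> ` cocycles L p = supported_on T"
  proof
    show "\<phi> ` cocycles L p \<subseteq> supported_on T" using supp by (auto simp: supported_on_def)
    show "supported_on T \<subseteq> \<phi> ` cocycles L p"
    proof
      fix c assume "c \<in> supported_on T"
      then obtain f where "f \<in> cocycles L p" "\<phi> f = c" using surj by blast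
      then show "c \<in> \<phi> ` cocycles L p" by blast
    qed
  qed
  moreover have "coboundaries L p = {f \<in> cocycles L p. \<phi> f = (\<lambda>t. 0)}"
    using coboundaries_subset_cocycles[OF L, of p] ker by auto
  ultimately have "coordinates (reduced_cohomology L p) T (\<lambda>X. \<phi> (SOME f. f \<in> X))"
    unfolding reduced_cohomology_def by (intro coordinates_quotient[OF vs lin]) simp_all
  then show ?thesis by blast
qed

definition cohomology_class :: "nat set set \<Rightarrow> int \<Rightarrow> (nat set \<Rightarrow> real) \<Rightarrow> (nat set \<Rightarrow> real) set" where
  "cohomology_class L p f = {\<lambda>\<sigma>. h \<sigma> + f \<sigma> | h. h \<in> coboundaries L p}"

lemma carrier_reduced_cohomology:
  "carrier (reduced_cohomology L p) = cohomology_class L p ` cocycles L p"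
  by (auto simp: reduced_cohomology_def quotient_module_def A_RCOSETS_def' a_r_coset_def'
      cohomology_class_def cochains_def)

lemma zero_reduced_cohomology:
  "\<zero>\<^bsub>reduced_cohomology L p\<^esub> = cohomology_class L p (\<lambda>\<sigma>. 0)"
  by (simp add: reduced_cohomology_def quotient_module_def cohomology_class_def)

text \<open>The inclusion-induced map is well defined on classes because the restriction of a coboundary of
  \<open>L'\<close> is a coboundary of \<open>L\<close>, with the same primitive.\<close>
lemma cohomology_restrict_class:
  assumes L: "down_closed L" "down_closed L'" "L \<subseteq> L'"
  shows "cohomology_restrict L p (cohomology_class L' p f) = cohomology_class L p (restrict_cochain L f)"
proof -
  have simp_L: "\<sigma> \<in> simplices L p \<longleftrightarrow> \<sigma> \<in> L \<and> \<sigma> \<in> simplices L' p" for \<sigma>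
    using L by (auto simp: simplices_def)
  have res: "restrict_cochain L h \<in> coboundaries L p" if "h \<in> coboundaries L' p" for h
  proof -
    from that obtain h' where "h = (\<lambda>\<sigma>. if \<sigma> \<in> simplices L' p then face_sum h' \<sigma> else 0)"
      by (auto simp: coboundaries_iff L)
    then show ?thesis unfolding coboundaries_iff[OF L(1)]
      by (intro exI[of _ h']) (auto simp: restrict_cochain_def simp_L)
  qed
  have add: "(\<lambda>\<sigma>. g \<sigma> + h \<sigma>) \<in> coboundaries L p"
    if "g \<in> coboundaries L p" "h \<in> coboundaries L p" for g h
  proof -
    from that obtain g' h' where
      "g = (\<lambda>\<sigma>. if \<sigma> \<in> simplices L p then face_sum g' \<sigma> else 0)"
      "h = (\<lambda>\<sigma>. if \<sigma> \<in> simplices L p then face_sum h' \<sigma> else 0)"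
      by (auto simp: coboundaries_iff L)
    then show ?thesis unfolding coboundaries_iff[OF L(1)]
      by (intro exI[of _ "\<lambda>\<sigma>. g' \<sigma> + h' \<sigma>"]) (auto simp: face_sum_linear)
  qed
  have zero: "(\<lambda>\<sigma>. 0) \<in> coboundaries L' p"
    unfolding coboundaries_iff[OF L(2)]
    by (intro exI[of _ "\<lambda>\<sigma>. 0"]) (auto simp: face_sum_zero)
  have split: "restrict_cochain L (\<lambda>\<sigma>. h \<sigma> + f \<sigma>) = (\<lambda>\<sigma>. restrict_cochain L h \<sigma> + restrict_cochain L f \<sigma>)" for h
    by (auto simp: restrict_cochain_def)
  show ?thesis
  proof (intro equalityI subsetI)
    fix x assume "x \<in> cohomology_restrict L p (cohomology_class L' p f)"
    then obtain g h where gh: "g \<in> coboundaries L p" "h \<in> coboundaries L' p"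
      "x = (\<lambda>\<sigma>. g \<sigma> + (restrict_cochain L h \<sigma> + restrict_cochain L f \<sigma>))"
      by (auto simp: cohomology_restrict_def set_add_def' cohomology_class_def cochains_def split)
    then show "x \<in> cohomology_class L p (restrict_cochain L f)"
      unfolding cohomology_class_def using add[OF gh(1) res[OF gh(2)]]
      by (intro CollectI exI[of _ "\<lambda>\<sigma>. g \<sigma> + restrict_cochain L h \<sigma>"]) (simp add: add.assoc)
  next
    fix x assume "x \<in> cohomology_class L p (restrict_cochain L f)"
    then obtain g where g: "g \<in> coboundaries L p" "x = (\<lambda>\<sigma>. g \<sigma> + restrict_cochain L f \<sigma>)"
      by (auto simp: cohomology_class_def)
    have "f \<in> cohomology_class L' p f"
      unfolding cohomology_class_def using zero by (intro CollectI exI[of _ "\<lambda>\<sigma>. 0"]) simp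
    then have "restrict_cochain L f \<in> restrict_cochain L ` cohomology_class L' p f"
      by (rule imageI)
    moreover have "x = g \<oplus>\<^bsub>cochains L p\<^esub> restrict_cochain L f"
      using g by (simp add: cochains_def)
    ultimately show "x \<in> cohomology_restrict L p (cohomology_class L' p f)"
      using g(1) unfolding cohomology_restrict_def set_add_def' by blast
  qed
qed

lemma restrict_cocycle:
  assumes L: "down_closed L" "L \<subseteq> L'" and f: "f \<in> cocycles L' p"
  shows "restrict_cochain L f \<in> cocycles L p"
proof -
  have "face_sum (restrict_cochain L f) \<sigma> = face_sum f \<sigma>" if "\<sigma> \<in> simplices L (p + 1)" for \<sigma>
    using facet_in_simplices[OF L(1) that]
    by (intro face_sum_cong) (simp add: restrict_cochain_def simplices_def)
  then show ?thesis using f L by (auto simp: cocycles_iff restrict_cochain_def simplices_def)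
qed

lemma down_closed_full_subcomplex:
  assumes "simplicial_complex_on m K"
  shows "down_closed (full_subcomplex K I)"
  using assms unfolding simplicial_complex_on_def down_closed_def full_subcomplex_def by blast

lemma coordinates_empty:
  assumes "coordinates V {} \<phi>"
  shows "carrier V = {\<zero>\<^bsub>V\<^esub>}"
proof -
  have "inj_on \<phi> (carrier V)" "\<phi> ` carrier V = {\<lambda>t. 0}" "\<zero>\<^bsub>V\<^esub> \<in> carrier V"
    using assms by (auto simp: coordinates_def bij_betw_def supported_on_def linear_forms_def)
  then show ?thesis by (auto simp: inj_on_def) (metis imageI singletonD)
qed

lemma coordinates_vectorspace:
  assumes "coordinates V T \<phi>"
  shows "vectorspace class_ring V"
  using assms unfolding coordinates_def bij_betw_def
  by (intro vectorspace_of_injective_forms[of V \<phi>]) simp_all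

section \<open>Double cohomology with zero differential\<close>

text \<open>Every component of \<open>d'\<close> goes from a summand \<open>(p, I)\<close> to a summand \<open>(p, I - {i})\<close>. If one of the
  two is always zero then \<open>d' = 0\<close>, and the double cohomology is the quotient of the cohomology of
  the moment-angle complex by its zero subspace.\<close>
lemma rank_double_cohomology_sparse:
  fixes T :: "int \<Rightarrow> nat set \<Rightarrow> 't set"
  assumes K: "simplicial_complex_on m K"
    and co: "\<And>p I. I \<subseteq> {1..m} \<Longrightarrow> \<exists>\<Phi>. coordinates (reduced_cohomology (full_subcomplex K I) p) (T p I) \<Phi>"
    and sparse: "\<And>p i I. i \<in> I \<Longrightarrow> I \<subseteq> {1..m} \<Longrightarrow> T p I = {} \<or> T p (I - {i}) = {}"
    and fin: "finite (SIGMA (p, I):moment_angle_index m. T p I)"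
  shows "rank_double_cohomology m K = card (SIGMA (p, I):moment_angle_index m. T p I)"
proof -
  let ?A = "moment_angle_index m" and ?T = "\<lambda>(p, I). T p I"
  let ?M = "\<lambda>(p, I). reduced_cohomology (full_subcomplex K I) p"
  define H where "H = moment_angle_cohomology m K"
  have "\<forall>i\<in>?A. \<exists>\<Phi>. coordinates (?M i) (?T i) \<Phi>"
    using co by (auto simp: moment_angle_index_def)
  then obtain \<Phi> where "coordinates (?M i) (?T i) (\<Phi> i)" if "i \<in> ?A" for i
    unfolding Bex_def by metis
  from coordinates_module_sum[OF this fin]
  obtain \<Psi> where \<Psi>: "coordinates H (Sigma ?A ?T) \<Psi>"
    by (auto simp: H_def moment_angle_cohomology_def)
  have \<psi>0: "psi K p i (insert i J) (x (p, insert i J)) = \<zero>\<^bsub>?M (p, J)\<^esub>"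
    if x: "x \<in> carrier H" and J: "J \<subseteq> {1..m}" and i: "i \<in> {1..m} - J" for x p i J
  proof -
    let ?I = "insert i J"
    let ?L = "full_subcomplex K J" and ?L' = "full_subcomplex K ?I"
    have LL: "down_closed ?L" "down_closed ?L'" "?L \<subseteq> ?L'"
      using down_closed_full_subcomplex[OF K] by (auto simp: full_subcomplex_def)
    have Ji: "?I - {i} = J" using i by auto
    have "x (p, ?I) \<in> carrier (?M (p, ?I))"
      using x i J by (auto simp: H_def moment_angle_cohomology_def module_sum_def moment_angle_index_def PiE_iff)
    then obtain f where f: "f \<in> cocycles ?L' p" "x (p, ?I) = cohomology_class ?L' p f"
      by (auto simp: carrier_reduced_cohomology)
    have psi: "psi K p i ?I (cohomology_class ?L' p g) = cohomology_class ?L p (restrict_cochain ?L g)" for g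
      unfolding psi_def Ji by (rule cohomology_restrict_class[OF LL])
    have "T p ?I = {} \<or> T p (?I - {i}) = {}"
      by (rule sparse) (use i J in auto)
    then consider "T p ?I = {}" | "T p J = {}" unfolding Ji by blast
    then show ?thesis
    proof cases
      case 1
      have "?I \<subseteq> {1..m}" using i J by auto
      from co[OF this, of p] obtain \<phi> where "coordinates (reduced_cohomology ?L' p) ({} :: 't set) \<phi>"
        unfolding 1 by blast
      then have "carrier (?M (p, ?I)) = {\<zero>\<^bsub>?M (p, ?I)\<^esub>}"
        by (simp add: coordinates_empty)
      then have "x (p, ?I) = cohomology_class ?L' p (\<lambda>\<sigma>. 0)"
        using \<open>x (p, ?I) \<in> _\<close> by (simp add: zero_reduced_cohomology)
      then show ?thesis by (simp add: psi zero_reduced_cohomology restrict_cochain_def)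
    next
      case 2
      from co[OF J, of p] obtain \<phi> where "coordinates (reduced_cohomology ?L p) ({} :: 't set) \<phi>"
        unfolding 2 by blast
      then have "carrier (?M (p, J)) = {\<zero>\<^bsub>?M (p, J)\<^esub>}"
        by (simp add: coordinates_empty)
      moreover have "psi K p i ?I (x (p, ?I)) \<in> carrier (?M (p, J))"
        unfolding f psi using restrict_cocycle[OF LL(1,3) f(1)] by (simp add: carrier_reduced_cohomology)
      ultimately show ?thesis by blast
    qed
  qed
  have d0: "double_differential m K x = \<zero>\<^bsub>H\<^esub>" if x: "x \<in> carrier H" for x
  proof
    fix pJ :: "int \<times> nat set"
    obtain p J where pJ: "pJ = (p, J)" by fastforce
    show "double_differential m K x pJ = \<zero>\<^bsub>H\<^esub> pJ"
    proof (cases "J \<subseteq> {1..m}")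
      case False
      then show ?thesis
        by (simp add: pJ double_differential_def H_def moment_angle_cohomology_def module_sum_def moment_angle_index_def)
    next
      case J: True
      interpret N: vectorspace "class_ring :: real ring" "?M (p, J)"
        using co[OF J, of p] coordinates_vectorspace by auto
      have "double_differential m K x pJ =
          (\<Oplus>\<^bsub>?M (p, J)\<^esub>i\<in>{1..m} - J. ((- 1) powi (p + 1) * eps i (insert i J))
             \<odot>\<^bsub>?M (p, J)\<^esub> psi K p i (insert i J) (x (p, insert i J)))"
        using J by (simp add: pJ double_differential_def moment_angle_index_def)
      also have "\<dots> = (\<Oplus>\<^bsub>?M (p, J)\<^esub>i\<in>{1..m} - J. \<zero>\<^bsub>?M (p, J)\<^esub>)"
      proof (rule N.finsum_cong'[OF refl])
        fix i assume "i \<in> {1..m} - J"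
        then show "((- 1) powi (p + 1) * eps i (insert i J))
             \<odot>\<^bsub>?M (p, J)\<^esub> psi K p i (insert i J) (x (p, insert i J)) = \<zero>\<^bsub>?M (p, J)\<^esub>"
          using N.smult_r_null by (simp add: \<psi>0[OF x J])
      qed (use N.zero_closed in auto)
      also have "\<dots> = \<zero>\<^bsub>H\<^esub> pJ"
        using J N.finsum_zero
        by (simp add: pJ H_def moment_angle_cohomology_def module_sum_def moment_angle_index_def)
      finally show ?thesis .
    qed
  qed
  have lin: "linear_forms H \<Psi>" and bij: "bij_betw \<Psi> (carrier H) (supported_on (Sigma ?A ?T))"
    using \<Psi> by (auto simp: coordinates_def)
  note D = linear_formsD[OF lin]
  have ker: "a_kernel H H (double_differential m K) = carrier H"
    using d0 by (auto simp: a_kernel_def')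
  have im: "double_differential m K ` carrier H = {x \<in> carrier H. \<Psi> x = (\<lambda>t. 0)}"
  proof -
    have "double_differential m K ` carrier H = {\<zero>\<^bsub>H\<^esub>}" using d0 D(1) by force
    also have "\<dots> = {x \<in> carrier H. \<Psi> x = (\<lambda>t. 0)}"
      using D(1,2) bij_betw_imp_inj_on[OF bij] by (auto dest: inj_onD[where y = "\<zero>\<^bsub>H\<^esub>"])
    finally show ?thesis .
  qed
  have "double_cohomology m K = quotient_module H (double_differential m K ` carrier H)"
    by (simp add: double_cohomology_def Let_def H_def[symmetric] ker)
  then have "\<exists>\<phi>. coordinates (double_cohomology m K) (Sigma ?A ?T) \<phi>"
    using coordinates_quotient[OF coordinates_vectorspace[OF \<Psi>] lin bij_betw_imp_surj_on[OF bij] im] by auto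
  then show ?thesis
    unfolding rank_double_cohomology_def using dim_eq_card_coordinates fin by blast
qed

section \<open>Cohomology of cones and boundaries of simplices\<close>

lemma coordinates_irrelevant_complex:
  "\<exists>\<Phi>. coordinates (reduced_cohomology {{}} p) (if p = -1 then {0 :: nat} else {}) \<Phi>"
proof (rule coordinates_reduced_cohomology[where \<phi> = "\<lambda>f t. if t = 0 then f {} else 0"])
  have simp_iff: "\<sigma> \<in> simplices {{}} q \<longleftrightarrow> \<sigma> = {} \<and> q = -1" for \<sigma> q
    by (auto simp: simplices_def)
  show L: "down_closed {{} :: nat set}" by (auto simp: down_closed_def)
  show "(if t = 0 then f {} else 0) = 0"
    if "f \<in> cocycles {{}} p" "t \<notin> (if p = -1 then {0 :: nat} else {})" for f t
    using that by (auto simp: cocycles_iff simp_iff split: if_splits)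
  show "\<exists>f\<in>cocycles {{}} p. (\<lambda>t. if t = 0 then f {} else 0) = c"
    if "c \<in> supported_on (if p = -1 then {0 :: nat} else {})" for c
    using that
    by (intro bexI[of _ "\<lambda>\<sigma>. if \<sigma> = {} then c 0 else 0"])
      (auto simp: cocycles_iff simp_iff supported_on_def face_sum_def fun_eq_iff split: if_splits)
  show "(\<lambda>t :: nat. if t = 0 then f {} else 0) = (\<lambda>t. 0) \<longleftrightarrow> f \<in> coboundaries {{}} p"
    if "f \<in> cocycles {{}} p" for f
    using that by (auto simp: coboundaries_iff[OF L] cocycles_iff simp_iff face_sum_def fun_eq_iff)
qed auto

text \<open>In a cone with apex \<open>v\<close> the sets \<open>insert v \<sigma>\<close> are faces, so there is no obstruction in
  \<open>coboundary_criterion\<close> for any cocycle.\<close>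
lemma coordinates_cone:
  assumes L: "down_closed L" and v: "\<And>\<sigma>. \<sigma> \<in> L \<Longrightarrow> insert v \<sigma> \<in> L"
  shows "\<exists>\<Phi>. coordinates (reduced_cohomology L p) ({} :: 't set) \<Phi>"
proof (rule coordinates_reduced_cohomology[where \<phi> = "\<lambda>f t. 0"])
  show "(\<lambda>t :: 't. 0 :: real) = (\<lambda>t. 0) \<longleftrightarrow> f \<in> coboundaries L p" if f: "f \<in> cocycles L p" for f
  proof -
    have "f \<in> coboundaries L p"
    proof (rule coboundary_criterion[OF L, where e = "\<lambda>\<sigma>. 0"])
      fix \<sigma> assume "\<sigma> \<in> simplices L p" "v \<notin> \<sigma>"
      then have "insert v \<sigma> \<in> simplices L (p + 1)" using v by (auto simp: simplices_def)
      then show "face_sum f (insert v \<sigma>) = face_sum (\<lambda>\<sigma>. 0) (insert v \<sigma>)"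
        using f by (simp add: cocycles_iff face_sum_zero)
    qed (use f in \<open>auto simp: cocycles_iff\<close>)
    then show ?thesis by simp
  qed
  show "\<exists>f\<in>cocycles L p. (\<lambda>t. 0) = c" if "c \<in> supported_on ({} :: 't set)" for c
    using that by (intro bexI[of _ "\<lambda>\<sigma>. 0"]) (auto simp: supported_on_def cocycles_iff face_sum_zero)
qed (use L in auto)

lemma face_sum_single_face:
  assumes "finite S" "v \<in> S" and "\<And>u. u \<in> S \<Longrightarrow> u \<noteq> v \<Longrightarrow> f (S - {u}) = 0"
  shows "face_sum f S = eps v S * f (S - {v})"
proof -
  have "face_sum f S = (\<Sum>u\<in>S. if u = v then eps v S * f (S - {v}) else 0)"
    unfolding face_sum_def using assms(3) by (intro sum.cong) auto
  then show ?thesis using assms by simp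
qed

text \<open>The only non-face in sight is \<open>F\<close> itself, and the coordinate of a class is the value there of the
  coboundary of a representing cocycle, taken in the full simplex. It can be nonzero only for cochains
  on the facets of \<open>F\<close>, that is, in degree \<open>card F - 2\<close>.\<close>
lemma coordinates_simplex_boundary:
  assumes fin: "finite F" and ne: "F \<noteq> {}"
  shows "\<exists>\<Phi>. coordinates (reduced_cohomology {\<sigma>. \<sigma> \<subset> F} p) (if p = int (card F) - 2 then {0 :: nat} else {}) \<Phi>"
    (is "\<exists>\<Phi>. coordinates (reduced_cohomology ?L p) ?T \<Phi>")
proof (rule coordinates_reduced_cohomology[where \<phi> = "\<lambda>f t. if t = 0 then face_sum f F else 0"])
  obtain v where v: "v \<in> F" using ne by auto
  show L: "down_closed ?L" by (auto simp: down_closed_def)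
  have facet: "F - {u} \<in> simplices ?L p \<longleftrightarrow> p = int (card F) - 2" if "u \<in> F" for u
    using that fin card_gt_0_iff[of F] by (auto simp: simplices_def card_Diff_singleton of_nat_diff)
  have zero: "face_sum f F = 0" if "f \<in> cocycles ?L p" "p \<noteq> int (card F) - 2" for f
    using that facet by (simp add: face_sum_def cocycles_iff)
  then show "(if t = 0 then face_sum f F else 0) = 0" if "f \<in> cocycles ?L p" "t \<notin> ?T" for f t
    using that by (auto split: if_splits)
  show "\<exists>f\<in>cocycles ?L p. (\<lambda>t. if t = 0 then face_sum f F else 0) = c" if c: "c \<in> supported_on ?T" for c
  proof (cases "p = int (card F) - 2")
    case True
    define f where "f \<sigma> = (if \<sigma> = F - {v} then eps v F * c 0 else 0)" for \<sigma>
    have "face_sum f F = eps v F * f (F - {v})"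
      by (rule face_sum_single_face[OF fin v]) (use v in \<open>auto simp: f_def\<close>)
    then have "face_sum f F = c 0"
      using eps_square[of v F] by (simp add: f_def flip: mult.assoc)
    then have "(\<lambda>t. if t = 0 then face_sum f F else 0) = c"
      using c True by (auto simp: supported_on_def fun_eq_iff)
    moreover have "\<sigma> \<notin> simplices ?L (p + 1)" for \<sigma>
    proof
      assume \<sigma>: "\<sigma> \<in> simplices ?L (p + 1)"
      then have "\<sigma> \<subset> F" by (simp add: simplices_def)
      from psubset_card_mono[OF fin this] \<sigma> True show False by (simp add: simplices_def)
    qed
    then have "f \<in> cocycles ?L p"
      using facet[OF v] True by (auto simp: cocycles_iff f_def)
    ultimately show ?thesis by blast
  next
    case False
    then show ?thesis using c
      by (intro bexI[of _ "\<lambda>\<sigma>. 0"]) (auto simp: supported_on_def cocycles_iff face_sum_zero)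
  qed
  show "(\<lambda>t :: nat. if t = 0 then face_sum f F else 0) = (\<lambda>t. 0) \<longleftrightarrow> f \<in> coboundaries ?L p"
    if f: "f \<in> cocycles ?L p" for f
  proof
    assume "(\<lambda>t :: nat. if t = 0 then face_sum f F else 0) = (\<lambda>t. 0)"
    from fun_cong[OF this, of 0] have fF: "face_sum f F = 0" by simp
    show "f \<in> coboundaries ?L p"
    proof (rule coboundary_criterion[OF L, where e = "\<lambda>\<sigma>. 0" and v = v])
      fix \<sigma> assume \<sigma>: "\<sigma> \<in> simplices ?L p" "v \<notin> \<sigma>"
      have "insert v \<sigma> = F \<or> insert v \<sigma> \<in> simplices ?L (p + 1)"
        using \<sigma> v by (auto simp: simplices_def)
      then show "face_sum f (insert v \<sigma>) = face_sum (\<lambda>\<sigma>. 0) (insert v \<sigma>)"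
        using f fF by (auto simp: cocycles_iff face_sum_zero)
    qed (use f in \<open>auto simp: cocycles_iff\<close>)
  next
    assume cb: "f \<in> coboundaries ?L p"
    have "face_sum f F = 0"
    proof (cases "p = int (card F) - 2")
      case True
      then show ?thesis using facet by (intro face_sum_coboundary[OF L cb fin]) simp
    qed (rule zero[OF f])
    then show "(\<lambda>t :: nat. if t = 0 then face_sum f F else 0) = (\<lambda>t. 0)" by auto
  qed
qed (auto simp: face_sum_linear)

section \<open>The block complex\<close>

definition vertices :: "nat \<Rightarrow> nat set" where
  "vertices r = {1..2 * r + 2}"

definition missing_face :: "nat \<Rightarrow> nat \<Rightarrow> nat set" where
  "missing_face r i = vertices r - {i, r + i}"

text \<open>This is the Alexander dual of the disjoint union of the edges \<open>{i, r + i}\<close>, with \<open>2 * r + 1\<close> and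
  \<open>2 * r + 2\<close> as ghost vertices of the dual. These two vertices belong to all missing faces; for
  \<open>r = 1\<close> they keep the missing face from being empty, and \<open>2 * r + 2\<close> serves as the apex in all
  applications of the cone operator to the whole complex.\<close>
definition block_complex :: "nat \<Rightarrow> nat set set" where
  "block_complex r = {\<sigma>. \<sigma> \<subseteq> vertices r \<and> (\<forall>i\<in>{1..r}. \<not> missing_face r i \<subseteq> \<sigma>)}"

lemma vertices_facts: "finite (vertices r)" "card (vertices r) = 2 * r + 2"
  "i \<in> {1..r} \<Longrightarrow> i \<in> vertices r" "i \<in> {1..r} \<Longrightarrow> r + i \<in> vertices r"
  "2 * r + 1 \<in> vertices r" "2 * r + 2 \<in> vertices r"
  "Suc (2 * r) \<in> vertices r" "Suc (Suc (2 * r)) \<in> vertices r"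
  by (auto simp: vertices_def)

lemma card_missing_face: "i \<in> {1..r} \<Longrightarrow> card (missing_face r i) = 2 * r"
  unfolding missing_face_def by (subst card_Diff_subset) (auto simp: vertices_facts)

lemma missing_face_inj: "i \<in> {1..r} \<Longrightarrow> j \<in> {1..r} \<Longrightarrow> missing_face r i = missing_face r j \<longleftrightarrow> i = j"
proof -
  assume ij: "i \<in> {1..r}" "j \<in> {1..r}"
  have "i \<notin> missing_face r i" by (simp add: missing_face_def)
  moreover have "i \<in> missing_face r j" if "i \<noteq> j" using that ij by (auto simp: missing_face_def vertices_def)
  ultimately show ?thesis by auto
qed

text \<open>Faces are best described through their complements: a set is a non-face iff its complement is
  contained in one of the pairs.\<close>
lemma complement_in_block_complex:
  assumes "A \<subseteq> vertices r"
  shows "vertices r - A \<in> block_complex r \<longleftrightarrow> (\<forall>i\<in>{1..r}. \<not> A \<subseteq> {i, r + i})"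
  using assms unfolding block_complex_def missing_face_def by blast

lemma simplicial_block_complex: "simplicial_complex_on (2 * r + 2) (block_complex r)"
proof -
  have ends: "2 * r + 1 \<in> missing_face r i" "2 * r + 2 \<in> missing_face r i" if "i \<in> {1..r}" for i
    using that by (auto simp: missing_face_def vertices_def)
  have "\<not> missing_face r i \<subseteq> {j}" if "i \<in> {1..r}" for i j
  proof
    assume "missing_face r i \<subseteq> {j}"
    then have "2 * r + 1 = j" "2 * r + 2 = j" using ends[OF that] by blast+
    then show False by simp
  qed
  then have "{j} \<in> block_complex r" if "j \<in> vertices r" for j
    using that by (simp add: block_complex_def)
  moreover have "{} \<in> block_complex r" using ends by (force simp: block_complex_def)
  moreover have "\<tau> \<in> block_complex r" if "\<sigma> \<in> block_complex r" "\<tau> \<subseteq> \<sigma>" for \<sigma> \<tau>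
    using that unfolding block_complex_def by blast
  moreover have "block_complex r \<subseteq> Pow (vertices r)" by (auto simp: block_complex_def)
  ultimately show ?thesis
    unfolding simplicial_complex_on_def vertices_def by blast
qed

lemma down_closed_block_complex: "down_closed (block_complex r)"
  using simplicial_block_complex unfolding simplicial_complex_on_def down_closed_def by blast

section \<open>Cohomology of the whole block complex\<close>

text \<open>A cochain in degree \<open>2 * r - 1\<close> that vanishes on the faces is a combination of the indicator
  functions of the missing faces. Its coboundary on the two sets \<open>V - {i}\<close> and \<open>V - {r + i}\<close>
  involves only the missing face \<open>V - {i, r + i}\<close>, whence one linear relation between the two
  values.\<close>
lemma face_sum_block_relation:
  assumes "i \<in> {1..r}"
    and e: "\<And>u v. u \<in> vertices r \<Longrightarrow> v \<in> vertices r \<Longrightarrow> u \<noteq> v \<Longrightarrow>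
              vertices r - {u, v} \<in> block_complex r \<Longrightarrow> e (vertices r - {u, v}) = 0"
  shows "face_sum e (vertices r - {i}) = eps (r + i) (vertices r - {i}) * e (missing_face r i)"
    and "eps i (vertices r) * face_sum e (vertices r - {i}) +
         eps (r + i) (vertices r) * face_sum e (vertices r - {r + i}) = 0"
proof -
  let ?V = "vertices r"
  have V: "finite ?V" "i \<in> ?V" "r + i \<in> ?V" "i \<noteq> r + i" using assms(1) by (auto simp: vertices_facts)
  have in_K: "?V - {u, w} \<in> block_complex r"
    if "u \<in> {i, r + i}" "w \<in> ?V" "w \<notin> {i, r + i}" for u w
    using that V assms(1) by (subst complement_in_block_complex) auto
  have "face_sum e (?V - {i}) = eps (r + i) (?V - {i}) * e (?V - {i} - {r + i})"
  proof (rule face_sum_single_face)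
    fix u assume "u \<in> ?V - {i}" "u \<noteq> r + i"
    then have "e (?V - {i, u}) = 0" using V in_K by (intro e) auto
    then show "e (?V - {i} - {u}) = 0" by (simp flip: Diff_insert2)
  qed (use V in auto)
  then show 1: "face_sum e (?V - {i}) = eps (r + i) (?V - {i}) * e (missing_face r i)"
    by (simp add: missing_face_def flip: Diff_insert2)
  have "face_sum e (?V - {r + i}) = eps i (?V - {r + i}) * e (?V - {r + i} - {i})"
  proof (rule face_sum_single_face)
    fix u assume "u \<in> ?V - {r + i}" "u \<noteq> i"
    then have "e (?V - {r + i, u}) = 0" using V in_K by (intro e) auto
    then show "e (?V - {r + i} - {u}) = 0" by (simp flip: Diff_insert2)
  qed (use V in auto)
  then have 2: "face_sum e (?V - {r + i}) = eps i (?V - {r + i}) * e (missing_face r i)"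
    by (simp add: missing_face_def insert_commute flip: Diff_insert2)
  have "(eps i ?V * eps (r + i) (?V - {i}) + eps (r + i) ?V * eps i (?V - {r + i})) * e (missing_face r i) = 0"
    using eps_swap[of ?V i "r + i"] V by simp
  then show "eps i ?V * face_sum e (?V - {i}) + eps (r + i) ?V * face_sum e (?V - {r + i}) = 0"
    unfolding 1 2 by (simp add: algebra_simps)
qed

lemma codim_one_subset:
  assumes "\<sigma> \<subseteq> vertices r" "card \<sigma> = 2 * r + 1"
  obtains u where "u \<in> vertices r" "\<sigma> = vertices r - {u}"
proof -
  have "card (vertices r - \<sigma>) = 1"
    using assms by (subst card_Diff_subset) (auto simp: vertices_facts finite_subset[OF _ vertices_facts(1)])
  then obtain u where "vertices r - \<sigma> = {u}" by (auto simp: card_1_singleton_iff)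
  then show thesis using assms by (intro that[of u]) auto
qed

lemma full_subset:
  assumes "\<sigma> \<subseteq> vertices r" "card \<sigma> = 2 * r + 2"
  shows "\<sigma> = vertices r"
  using assms card_subset_eq[of "vertices r" \<sigma>] by (simp add: vertices_facts)

text \<open>The number \<open>u\<close> lies outside all pairs exactly if it is one of the two additional vertices.\<close>
lemma simplices_codim_one:
  assumes "u \<in> vertices r"
  shows "vertices r - {u} \<in> simplices (block_complex r) (2 * int r) \<longleftrightarrow> u \<in> {2 * r + 1, 2 * r + 2}"
proof -
  have "vertices r - {u} \<in> block_complex r \<longleftrightarrow> (\<forall>i\<in>{1..r}. u \<notin> {i, r + i})"
    using assms by (subst complement_in_block_complex) auto
  also have "\<dots> \<longleftrightarrow> u \<in> {2 * r + 1, 2 * r + 2}"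
  proof
    assume a: "\<forall>i\<in>{1..r}. u \<notin> {i, r + i}"
    show "u \<in> {2 * r + 1, 2 * r + 2}"
    proof (rule ccontr)
      assume "u \<notin> {2 * r + 1, 2 * r + 2}"
      then have "u \<in> {1..r} \<or> u - r \<in> {1..r} \<and> u = r + (u - r)"
        using assms by (auto simp: vertices_def)
      then show False using a by (metis insertI1 insertI2)
    qed
  qed auto
  finally show ?thesis
    using assms by (simp add: simplices_def vertices_facts card_Diff_singleton)
qed

lemma simplices_codim_two:
  assumes "u \<in> vertices r" "v \<in> vertices r" "u \<noteq> v"
  shows "vertices r - {u, v} \<in> simplices (block_complex r) (2 * int r - 1)
           \<longleftrightarrow> vertices r - {u, v} \<in> block_complex r"
  using assms by (auto simp: simplices_def vertices_facts card_Diff_subset)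

text \<open>A set \<open>insert (2 * r + 2) \<sigma>\<close> that is not a face contains a missing face, so it has at least
  \<open>2 * r\<close> elements, and obstructions exist only in degrees \<open>2 * r - 2\<close> to \<open>2 * r\<close>. In degree
  \<open>2 * r\<close> the obstruction is the value on \<open>V\<close>, which is removed by a cochain on the non-face
  \<open>V - {1}\<close>. In degree \<open>2 * r - 2\<close> it is the value on a missing face \<open>V - {i, r + i}\<close>, which must
  vanish: the coboundary squares to zero on \<open>V - {i}\<close>, and all other facets of this set are faces
  of the complex.\<close>
lemma block_complex_acyclic:
  assumes r: "r \<ge> 1" and p: "p \<noteq> 2 * int r - 1" and f: "f \<in> cocycles (block_complex r) p"
  shows "f \<in> coboundaries (block_complex r) p"
proof -
  let ?V = "vertices r" and ?K = "block_complex r" and ?w = "2 * r + 2"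
  have K: "\<sigma> \<subseteq> ?V" if "\<sigma> \<in> simplices ?K q" for \<sigma> q
    using that by (auto simp: simplices_def block_complex_def)
  have f0: "f \<sigma> = 0" if "\<sigma> \<notin> simplices ?K p" for \<sigma> using f that by (simp add: cocycles_iff)
  define e where "e \<sigma> = (if \<sigma> = ?V - {1} then eps 1 ?V * face_sum f ?V else 0)" for \<sigma>
  show ?thesis
  proof (cases "p = 2 * int r")
    case True
    show ?thesis
    proof (rule coboundary_criterion[OF down_closed_block_complex f0, where e = e and v = ?w])
      fix \<sigma> assume \<sigma>: "\<sigma> \<in> simplices ?K p"
      have "?V - {1} \<notin> simplices ?K p"
        using simplices_codim_one[of 1 r] r True by (simp add: vertices_def)
      then show "e \<sigma> = 0" using \<sigma> by (auto simp: e_def)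
      assume "?w \<notin> \<sigma>"
      then have "insert ?w \<sigma> = ?V"
        using \<sigma> K[OF \<sigma>] True by (intro full_subset) (auto simp: simplices_def vertices_def)
      moreover have one: "1 \<in> ?V" by (simp add: vertices_def)
      have "face_sum e ?V = eps 1 ?V * e (?V - {1})"
      proof (rule face_sum_single_face[OF vertices_facts(1) one])
        fix u assume "u \<in> ?V" "u \<noteq> 1"
        then have "?V - {u} \<noteq> ?V - {1}" by blast
        then show "e (?V - {u}) = 0" by (simp add: e_def)
      qed
      then have "face_sum e ?V = face_sum f ?V"
        using eps_square[of 1 ?V] by (simp add: e_def flip: mult.assoc)
      ultimately show "face_sum f (insert ?w \<sigma>) = face_sum e (insert ?w \<sigma>)" by simp
    qed
  next
    case False
    show ?thesis
    proof (rule coboundary_criterion[OF down_closed_block_complex f0, where e = "\<lambda>\<sigma>. 0" and v = ?w])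
      fix \<sigma> assume \<sigma>: "\<sigma> \<in> simplices ?K p" "?w \<notin> \<sigma>"
      let ?\<tau> = "insert ?w \<sigma>"
      have \<tau>: "?\<tau> \<subseteq> ?V" "finite ?\<tau>" "int (card ?\<tau>) = p + 2"
        using \<sigma> K[OF \<sigma>(1)] by (auto simp: simplices_def vertices_def)
      have "face_sum f ?\<tau> = 0"
      proof (cases "?\<tau> \<in> ?K")
        case True
        then have "?\<tau> \<in> simplices ?K (p + 1)" using \<tau> by (simp add: simplices_def)
        then show ?thesis using f by (simp add: cocycles_iff)
      next
        case nonface: False
        then obtain i where i: "i \<in> {1..r}" "missing_face r i \<subseteq> ?\<tau>"
          using \<tau>(1) unfolding block_complex_def by blast
        have "2 * r \<le> card ?\<tau>" "card ?\<tau> \<le> 2 * r + 2"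
          using card_mono[OF \<tau>(2) i(2)] card_mono[OF vertices_facts(1) \<tau>(1)] card_missing_face[OF i(1)]
          by (auto simp: vertices_facts)
        then have card: "card ?\<tau> = 2 * r" and p': "p + 1 = 2 * int r - 1" 
          using \<tau>(3) p False by linarith+
        then have eq: "missing_face r i = ?\<tau>"
          using card_subset_eq[OF \<tau>(2) i(2)] card_missing_face[OF i(1)] by simp
        let ?S = "?V - {i}"
        have "face_sum (face_sum f) ?S = eps (r + i) ?S * face_sum f (?S - {r + i})"
        proof (rule face_sum_single_face)
          fix u assume u: "u \<in> ?S" "u \<noteq> r + i"
          have "?V - {i, u} \<in> ?K"
            using u i(1) by (subst complement_in_block_complex) (auto simp: vertices_facts)
          then have "?V - {i, u} \<in> simplices ?K (p + 1)"
            unfolding p' using u i(1) by (subst simplices_codim_two) (auto simp: vertices_facts)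
          then show "face_sum f (?S - {u}) = 0" using f by (simp add: cocycles_iff flip: Diff_insert2)
        qed (use i(1) in \<open>auto simp: vertices_facts\<close>)
        moreover have "?S - {r + i} = ?\<tau>" unfolding eq[symmetric] missing_face_def by auto
        ultimately show ?thesis
          using face_sum_face_sum[of ?S f] by (simp add: vertices_facts eps_nonzero)
      qed
      then show "face_sum f ?\<tau> = face_sum (\<lambda>\<sigma>. 0) ?\<tau>" by (simp add: face_sum_zero)
    qed simp_all
  qed
qed

text \<open>The combination of the values of the coboundary of \<open>f\<close> on \<open>V - {i}\<close> and \<open>V - {r + i}\<close> that is
  unaffected by changing \<open>f\<close> on the missing faces, by \<open>face_sum_block_relation\<close>.\<close>
definition block_form :: "nat \<Rightarrow> (nat set \<Rightarrow> real) \<Rightarrow> nat \<Rightarrow> real" where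
  "block_form r f i =
     eps i (vertices r) * face_sum f (vertices r - {i}) +
     eps (r + i) (vertices r) * face_sum f (vertices r - {r + i})"

lemma sum_vertices:
  "sum g (vertices r) = (\<Sum>i=1..r. g i + g (r + i)) + g (2 * r + 1) + g (2 * r + 2)"
proof -
  have split: "{1..2 * r} = {1..r} \<union> (\<lambda>i. r + i) ` {1..r}"
  proof (intro equalityI subsetI)
    fix u assume "u \<in> {1..2 * r}"
    then have "u \<in> {1..r} \<or> u - r \<in> {1..r} \<and> u = r + (u - r)" by auto
    then show "u \<in> {1..r} \<union> (\<lambda>i. r + i) ` {1..r}" by (metis UnI1 UnI2 imageI)
  qed auto
  have "sum g {1..2 * r} = sum g {1..r} + sum g ((\<lambda>i. r + i) ` {1..r})"
    unfolding split by (rule sum.union_disjoint) auto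
  also have "sum g ((\<lambda>i. r + i) ` {1..r}) = (\<Sum>i=1..r. g (r + i))"
    by (subst sum.reindex) (simp_all add: inj_on_def)
  finally have "sum g {1..2 * r} = (\<Sum>i=1..r. g i + g (r + i))"
    by (simp add: sum.distrib)
  then show ?thesis by (simp add: vertices_def)
qed

text \<open>On the two facets of \<open>V\<close> that are faces the coboundary of a cocycle vanishes, so the sum is the
  square of the coboundary, evaluated on \<open>V\<close>. This is the reason why the rank is
  \<open>r - 1\<close> rather than \<open>r\<close>.\<close>
lemma sum_block_form:
  assumes f: "f \<in> cocycles (block_complex r) (2 * int r - 1)"
  shows "(\<Sum>i=1..r. block_form r f i) = 0"
proof -
  let ?V = "vertices r"
  have "face_sum f (?V - {u}) = 0" if "u \<in> {2 * r + 1, 2 * r + 2}" for u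
    using f simplices_codim_one[of u r] that by (auto simp: cocycles_iff vertices_facts)
  then have "face_sum (face_sum f) ?V = (\<Sum>i=1..r. block_form r f i)"
    unfolding face_sum_def[of "face_sum f"] sum_vertices block_form_def by simp
  then show ?thesis using face_sum_face_sum[of ?V f] by (simp add: vertices_facts)
qed

text \<open>A coboundary of the complex differs from one of the full simplex, which has vanishing coboundary,
  by a cochain on the missing faces.\<close>
lemma block_form_coboundary:
  assumes f: "f \<in> coboundaries (block_complex r) (2 * int r - 1)" and i: "i \<in> {1..r}"
  shows "block_form r f i = 0"
proof -
  let ?V = "vertices r" and ?S = "simplices (block_complex r) (2 * int r - 1)"
  obtain h where h: "f = (\<lambda>\<sigma>. if \<sigma> \<in> ?S then face_sum h \<sigma> else 0)"
    using f coboundaries_iff[OF down_closed_block_complex] by blast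
  define e where "e \<sigma> = (if \<sigma> \<in> ?S then 0 else face_sum h \<sigma>)" for \<sigma>
  have "f = (\<lambda>\<sigma>. face_sum h \<sigma> - e \<sigma>)" by (auto simp: h e_def)
  then have "face_sum f (?V - {u}) = - face_sum e (?V - {u})" for u
    by (simp add: face_sum_linear face_sum_face_sum vertices_facts)
  moreover have "eps i ?V * face_sum e (?V - {i}) + eps (r + i) ?V * face_sum e (?V - {r + i}) = 0"
    by (rule face_sum_block_relation(2)[OF i]) (auto simp: e_def simplices_codim_two)
  ultimately show ?thesis by (simp add: block_form_def)
qed

text \<open>The correction \<open>e\<close> on the missing face \<open>V - {i, r + i}\<close> is chosen to remove the obstruction on
  \<open>V - {i}\<close>; since the block form vanishes, it then also removes the one on \<open>V - {r + i}\<close>.\<close>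
lemma coboundary_of_block_form:
  assumes f: "f \<in> cocycles (block_complex r) (2 * int r - 1)"
    and zero: "\<And>i. i \<in> {1..<r} \<Longrightarrow> block_form r f i = 0"
  shows "f \<in> coboundaries (block_complex r) (2 * int r - 1)"
proof -
  let ?V = "vertices r" and ?K = "block_complex r" and ?w = "2 * r + 2"
  \<comment> \<open>The last form is determined by the others, since all of them add up to zero.\<close>
  have bf: "block_form r f i = 0" if i: "i \<in> {1..r}" for i
  proof (cases "i = r")
    case True
    have "{1..r} = insert r {1..<r}" using i True by auto
    then have "(\<Sum>j=1..r. block_form r f j) = block_form r f r + (\<Sum>j\<in>{1..<r}. block_form r f j)"
      by simp
    then show ?thesis using sum_block_form[OF f] zero True by simp
  qed (use i zero in auto)
  define e where "e \<sigma> = (\<Sum>i=1..r. if \<sigma> = missing_face r i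
      then eps (r + i) (?V - {i}) * face_sum f (?V - {i}) else 0)" for \<sigma>
  have e_missing: "e (missing_face r i) = eps (r + i) (?V - {i}) * face_sum f (?V - {i})"
    if i: "i \<in> {1..r}" for i
  proof -
    have "e (missing_face r i) = (\<Sum>j=1..r. if j = i
        then eps (r + i) (?V - {i}) * face_sum f (?V - {i}) else 0)"
      unfolding e_def by (intro sum.cong refl) (use i in \<open>auto simp: missing_face_inj\<close>)
    then show ?thesis using i by simp
  qed
  have e_K: "e \<sigma> = 0" if "\<sigma> \<in> ?K" for \<sigma>
    unfolding e_def using that by (intro sum.neutral) (auto simp: block_complex_def)
  have eq1: "face_sum e (?V - {i}) = face_sum f (?V - {i})" if i: "i \<in> {1..r}" for i
    using face_sum_block_relation(1)[OF i, of e] e_K e_missing[OF i] eps_square[of "r + i" "?V - {i}"]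
    by (simp flip: mult.assoc)
  have eq2: "face_sum e (?V - {r + i}) = face_sum f (?V - {r + i})" if i: "i \<in> {1..r}" for i
  proof -
    have "eps i ?V * face_sum e (?V - {i}) + eps (r + i) ?V * face_sum e (?V - {r + i}) = 0"
      by (rule face_sum_block_relation(2)[OF i]) (rule e_K)
    then have "eps (r + i) ?V * face_sum e (?V - {r + i}) = eps (r + i) ?V * face_sum f (?V - {r + i})"
      using bf[OF i] unfolding eq1[OF i] block_form_def by linarith
    then show ?thesis using eps_nonzero by simp
  qed
  show ?thesis
  proof (rule coboundary_criterion[OF down_closed_block_complex, where e = e and v = ?w])
    show "f \<sigma> = 0" if "\<sigma> \<notin> simplices ?K (2 * int r - 1)" for \<sigma>
      using f that by (simp add: cocycles_iff)
    fix \<sigma> assume \<sigma>: "\<sigma> \<in> simplices ?K (2 * int r - 1)"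
    then show "e \<sigma> = 0" using e_K by (simp add: simplices_def)
    assume w: "?w \<notin> \<sigma>"
    have "insert ?w \<sigma> \<subseteq> ?V" "card (insert ?w \<sigma>) = 2 * r + 1"
      using \<sigma> w by (auto simp: simplices_def block_complex_def vertices_def)
    then obtain u where u: "u \<in> ?V" "insert ?w \<sigma> = ?V - {u}" by (rule codim_one_subset)
    then have "u \<noteq> ?w" by auto
    then consider "u \<in> {1..r}" | "u - r \<in> {1..r}" "u = r + (u - r)" | "u = 2 * r + 1"
      using u(1) unfolding vertices_def by fastforce
    then show "face_sum f (insert ?w \<sigma>) = face_sum e (insert ?w \<sigma>)"
    proof cases
      case 1
      then show ?thesis unfolding u(2) by (rule eq1[symmetric])
    next
      case 2
      then show ?thesis unfolding u(2) using eq2[of "u - r"] by metis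
    next
      case 3
      then have S: "?V - {u} \<in> simplices ?K (2 * int r)" using simplices_codim_one u(1) by simp
      have "face_sum e (?V - {u}) = face_sum (\<lambda>\<sigma>. 0) (?V - {u})"
        using facet_in_simplices[OF down_closed_block_complex S] e_K
        by (intro face_sum_cong) (auto simp: simplices_def)
      moreover have "face_sum f (?V - {u}) = 0" using f S by (simp add: cocycles_iff)
      ultimately show ?thesis unfolding u(2) by (simp add: face_sum_zero)
    qed
  qed
qed

text \<open>Let \<open>g\<close> be the cochain on the sets \<open>V - {i}\<close>, \<open>i \<le> r\<close>, with the desired values. It is closed in
  the full simplex because the \<open>b i\<close> add up to zero, so that it is the coboundary of its cone \<open>f\<close>.
  The cone lives on the sets \<open>V - {i, 2 * r + 2}\<close>, which are faces.\<close>
lemma cocycle_with_block_form: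
  assumes b: "(\<Sum>i=1..r. b i) = 0"
  shows "\<exists>f\<in>cocycles (block_complex r) (2 * int r - 1). \<forall>i\<in>{1..r}. block_form r f i = b i"
proof -
  let ?V = "vertices r" and ?K = "block_complex r" and ?w = "2 * r + 2"
  define g where "g \<sigma> = (\<Sum>i=1..r. if \<sigma> = ?V - {i} then eps i ?V * b i else 0)" for \<sigma>
  define f where "f = cone ?w g"
  have g: "g (?V - {u}) = (if u \<in> {1..r} then eps u ?V * b u else 0)" if "u \<in> ?V" for u
  proof -
    have "g (?V - {u}) = (\<Sum>i=1..r. if i = u then eps u ?V * b u else 0)"
      unfolding g_def by (intro sum.cong refl) (use that in \<open>auto simp: vertices_facts\<close>)
    then show ?thesis by simp
  qed
  have fs: "face_sum f (?V - {u}) = g (?V - {u})" if "u \<in> ?V" "u \<noteq> ?w" for u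
    using cone_homotopy[of "?V - {u}" ?w g] that
    by (simp add: f_def cone_def vertices_facts)
  have "face_sum g ?V = (\<Sum>i=1..r. eps i ?V * (eps i ?V * b i))"
    unfolding face_sum_def sum_vertices by (simp add: g vertices_facts)
  also have "\<dots> = 0" using b by (simp add: eps_square flip: mult.assoc)
  finally have g0: "face_sum g ?V = 0" .
  have "f \<in> cocycles ?K (2 * int r - 1)"
    unfolding cocycles_iff
  proof (intro conjI allI impI ballI)
    fix \<sigma> assume \<sigma>: "\<sigma> \<notin> simplices ?K (2 * int r - 1)"
    show "f \<sigma> = 0"
    proof (rule ccontr)
      assume f\<sigma>: "f \<sigma> \<noteq> 0"
      then have w: "?w \<notin> \<sigma>" and "g (insert ?w \<sigma>) \<noteq> 0" by (auto simp: f_def cone_def split: if_splits)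
      have "\<exists>i\<in>{1..r}. insert ?w \<sigma> = ?V - {i}"
      proof (rule ccontr)
        assume "\<not> ?thesis"
        then have "g (insert ?w \<sigma>) = 0" unfolding g_def by (intro sum.neutral) auto
        then show False using \<open>g (insert ?w \<sigma>) \<noteq> 0\<close> by contradiction
      qed
      then obtain i where i: "i \<in> {1..r}" "insert ?w \<sigma> = ?V - {i}" by blast
      then have "\<sigma> = ?V - {i, ?w}" using w by auto
      moreover have "?V - {i, ?w} \<in> ?K"
        using i(1) by (subst complement_in_block_complex) (auto simp: vertices_facts)
      ultimately show False
        using \<sigma> simplices_codim_two[of i r ?w] i(1) by (auto simp: vertices_facts)
    qed
  next
    fix \<sigma> assume \<sigma>: "\<sigma> \<in> simplices ?K (2 * int r - 1 + 1)"
    then have "\<sigma> \<subseteq> ?V" "card \<sigma> = 2 * r + 1" by (auto simp: simplices_def block_complex_def)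
    then obtain u where u: "u \<in> ?V" "\<sigma> = ?V - {u}" by (rule codim_one_subset)
    then have "u \<in> {2 * r + 1, ?w}" using \<sigma> simplices_codim_one[of u r] by simp
    then consider "u = 2 * r + 1" | "u = ?w" by auto
    then show "face_sum f \<sigma> = 0"
    proof cases
      case 1
      then show ?thesis using fs[OF u(1)] g[OF u(1)] u(2) by simp
    next
      case 2
      have "insert ?w (?V - {?w}) = ?V" by (auto simp: vertices_facts)
      then have "cone ?w (face_sum g) (?V - {?w}) = 0" by (simp add: cone_def g0)
      then show ?thesis
        using cone_homotopy[of "?V - {?w}" ?w g] g[OF u(1)] u(2) 2 by (simp add: f_def vertices_facts)
    qed
  qed
  moreover have "block_form r f i = b i" if "i \<in> {1..r}" for i
    using that eps_square[of i ?V]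
    by (simp add: block_form_def fs g vertices_facts flip: mult.assoc)
  ultimately show ?thesis by blast
qed

lemma coordinates_block_complex:
  assumes "r \<ge> 1"
  shows "\<exists>\<Phi>. coordinates (reduced_cohomology (block_complex r) p)
            (if p = 2 * int r - 1 then {1..<r} else {}) \<Phi>"
proof (cases "p = 2 * int r - 1")
  case False
  have "\<exists>\<Phi>. coordinates (reduced_cohomology (block_complex r) p) ({} :: nat set) \<Phi>"
  proof (rule coordinates_reduced_cohomology[where \<phi> = "\<lambda>f t. 0"])
    show "\<exists>f\<in>cocycles (block_complex r) p. (\<lambda>t. 0) = c" if "c \<in> supported_on ({} :: nat set)" for c
      using that by (intro bexI[of _ "\<lambda>\<sigma>. 0"]) (auto simp: supported_on_def cocycles_iff face_sum_zero)
  qed (use block_complex_acyclic[OF assms False] down_closed_block_complex in auto)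
  then show ?thesis using False by simp
next
  case True
  let ?K = "block_complex r"
  have "\<exists>\<Phi>. coordinates (reduced_cohomology ?K (2 * int r - 1)) {1..<r} \<Phi>"
  proof (rule coordinates_reduced_cohomology[where \<phi> = "\<lambda>f t. if t \<in> {1..<r} then block_form r f t else 0"])
    show "\<exists>f\<in>cocycles ?K (2 * int r - 1). (\<lambda>t. if t \<in> {1..<r} then block_form r f t else 0) = c"
      if c: "c \<in> supported_on {1..<r}" for c
    proof -
      \<comment> \<open>The value for \<open>i = r\<close> is forced by the condition that the block forms add up to zero.\<close>
      define b where "b i = (if i = r then - sum c {1..<r} else c i)" for i
      have "{1..r} = insert r {1..<r}" using assms by auto
      then have "(\<Sum>i=1..r. b i) = 0" by (simp add: b_def)
      from cocycle_with_block_form[OF this] obtain f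
        where "f \<in> cocycles ?K (2 * int r - 1)" "\<forall>i\<in>{1..r}. block_form r f i = b i" by blast
      then show ?thesis
        using c by (intro bexI[of _ f]) (auto simp: b_def supported_on_def fun_eq_iff)
    qed
    show "(\<lambda>t. if t \<in> {1..<r} then block_form r f t else 0) = (\<lambda>t. 0) \<longleftrightarrow> f \<in> coboundaries ?K (2 * int r - 1)"
      if f: "f \<in> cocycles ?K (2 * int r - 1)" for f
      using coboundary_of_block_form[OF f] block_form_coboundary[of f r] by (auto simp: fun_eq_iff)
  qed (auto simp: down_closed_block_complex block_form_def face_sum_linear algebra_simps)
  then show ?thesis using True by simp
qed

section \<open>Rank of the double cohomology\<close>

text \<open>Index sets for coordinates on the cohomology of the full subcomplexes; their cardinalities are
  the Betti numbers.\<close>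
definition betti_index :: "nat \<Rightarrow> int \<Rightarrow> nat set \<Rightarrow> nat set" where
  "betti_index r p I =
    (if I = {} then if p = -1 then {0} else {}
     else if I = vertices r then if p = 2 * int r - 1 then {1..<r} else {}
     else if I \<in> missing_face r ` {1..r} then if p = 2 * int r - 2 then {0} else {}
     else {})"

lemma missing_face_proper:
  assumes "i \<in> {1..r}"
  shows "missing_face r i \<noteq> {}" "missing_face r i \<noteq> vertices r"
  using card_missing_face[OF assms] vertices_facts(2)[of r] assms by auto

lemma betti_index_iff:
  "t \<in> betti_index r p I \<longleftrightarrow>
     I = {} \<and> p = -1 \<and> t = 0 \<or>
     (\<exists>i\<in>{1..r}. I = missing_face r i) \<and> p = 2 * int r - 2 \<and> t = 0 \<or>
     I = vertices r \<and> p = 2 * int r - 1 \<and> t \<in> {1..<r}"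
proof -
  have ne: "vertices r \<noteq> {}" using vertices_facts(5)[of r] by blast
  consider "I = {}" | "I = vertices r" | i where "i \<in> {1..r}" "I = missing_face r i"
    | "I \<noteq> {}" "I \<noteq> vertices r" "\<not> (\<exists>i\<in>{1..r}. I = missing_face r i)" by blast
  then show ?thesis
  proof cases
    case 1
    then have "\<not> (\<exists>i\<in>{1..r}. I = missing_face r i)" using missing_face_proper(1) by blast
    then show ?thesis using 1 ne by (simp add: betti_index_def)
  next
    case 2
    then have "\<not> (\<exists>i\<in>{1..r}. I = missing_face r i)" using missing_face_proper(2) by blast
    then show ?thesis using 2 ne by (simp add: betti_index_def)
  next
    case 3
    then have "I \<noteq> {}" "I \<noteq> vertices r" "I \<in> missing_face r ` {1..r}" "\<exists>i\<in>{1..r}. I = missing_face r i"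
      using missing_face_proper by auto
    then show ?thesis by (simp add: betti_index_def)
  next
    case 4
    then have "I \<notin> missing_face r ` {1..r}" by blast
    then show ?thesis using 4 by (simp add: betti_index_def)
  qed
qed

text \<open>If \<open>I\<close> is not empty, not the whole vertex set and not a missing face, then it contains at most
  one missing face, because any two of them cover all vertices. Any vertex of \<open>I\<close> outside this
  missing face is the apex of a cone.\<close>
lemma coordinates_full_subcomplex:
  assumes r: "r \<ge> 1" and I: "I \<subseteq> vertices r"
  shows "\<exists>\<Phi>. coordinates (reduced_cohomology (full_subcomplex (block_complex r) I) p) (betti_index r p I) \<Phi>"
proof -
  let ?K = "block_complex r"
  consider "I = {}" | "I = vertices r" | i where "i \<in> {1..r}" "I = missing_face r i"
    | "I \<noteq> {}" "I \<noteq> vertices r" "I \<notin> missing_face r ` {1..r}" by blast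
  then show ?thesis
  proof cases
    case 1
    have "full_subcomplex ?K I = {{}}"
      using simplicial_block_complex[of r] 1 by (auto simp: full_subcomplex_def simplicial_complex_on_def)
    then show ?thesis using coordinates_irrelevant_complex[of p] 1 by (simp add: betti_index_def)
  next
    case 2
    have "full_subcomplex ?K I = ?K" using 2 by (auto simp: full_subcomplex_def block_complex_def)
    moreover have "vertices r \<noteq> {}" using vertices_facts(5)[of r] by auto
    ultimately show ?thesis using coordinates_block_complex[OF r, of p] 2 by (simp add: betti_index_def)
  next
    case 3
    have fin: "finite I" using I vertices_facts(1) by (rule finite_subset)
    have "full_subcomplex ?K I = {\<sigma>. \<sigma> \<subset> I}"
    proof (intro equalityI subsetI)
      fix \<sigma> assume "\<sigma> \<in> full_subcomplex ?K I"
      then show "\<sigma> \<in> {\<sigma>. \<sigma> \<subset> I}" using 3 by (auto simp: full_subcomplex_def block_complex_def)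
    next
      fix \<sigma> assume \<sigma>: "\<sigma> \<in> {\<sigma>. \<sigma> \<subset> I}"
      have "\<not> missing_face r j \<subseteq> \<sigma>" if "j \<in> {1..r}" for j
      proof
        assume "missing_face r j \<subseteq> \<sigma>"
        then have "missing_face r j \<subset> I" using \<sigma> by auto
        from psubset_card_mono[OF fin this] show False
          using 3 that by (simp add: card_missing_face)
      qed
      then show "\<sigma> \<in> full_subcomplex ?K I" using \<sigma> I by (auto simp: full_subcomplex_def block_complex_def)
    qed
    then show ?thesis
      using coordinates_simplex_boundary[OF fin, of p] 3 missing_face_proper by (simp add: betti_index_def card_missing_face)
  next
    case 4
    have "\<exists>v\<in>I. \<forall>i\<in>{1..r}. missing_face r i \<subseteq> I \<longrightarrow> v \<notin> missing_face r i"
    proof (cases "\<exists>i\<in>{1..r}. missing_face r i \<subseteq> I")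
      case False
      then show ?thesis using 4(1) by blast
    next
      case True
      then obtain i where i: "i \<in> {1..r}" "missing_face r i \<subseteq> I" by blast
      then obtain v where v: "v \<in> I" "v \<notin> missing_face r i" using 4(3) by blast
      have "j = i" if j: "j \<in> {1..r}" "missing_face r j \<subseteq> I" for j
      proof (rule ccontr)
        assume "j \<noteq> i"
        then have "missing_face r i \<union> missing_face r j = vertices r"
          using i(1) j(1) by (auto simp: missing_face_def)
        then show False using i j I 4(2) by blast
      qed
      then show ?thesis using v by blast
    qed
    then obtain v where v: "v \<in> I" "\<And>i. i \<in> {1..r} \<Longrightarrow> missing_face r i \<subseteq> I \<Longrightarrow> v \<notin> missing_face r i"
      by blast
    have "insert v \<sigma> \<in> full_subcomplex ?K I" if \<sigma>: "\<sigma> \<in> full_subcomplex ?K I" for \<sigma>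
    proof -
      have "\<not> missing_face r i \<subseteq> insert v \<sigma>" if i: "i \<in> {1..r}" for i
      proof
        assume sub: "missing_face r i \<subseteq> insert v \<sigma>"
        then have "missing_face r i \<subseteq> I" using \<sigma> v(1) by (auto simp: full_subcomplex_def)
        then have "missing_face r i \<subseteq> \<sigma>" using v(2)[OF i] sub by blast
        then show False using \<sigma> i by (auto simp: full_subcomplex_def block_complex_def)
      qed
      then show ?thesis using \<sigma> v(1) I by (auto simp: full_subcomplex_def block_complex_def)
    qed
    then have "\<exists>\<Phi>. coordinates (reduced_cohomology (full_subcomplex ?K I) p) ({} :: nat set) \<Phi>"
      using down_closed_full_subcomplex[OF simplicial_block_complex] by (rule coordinates_cone[rotated])
    then show ?thesis using 4 by (simp add: betti_index_def)
  qed
qed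

lemma rank_block_complex:
  assumes r: "r \<ge> 1"
  shows "rank_double_cohomology (2 * r + 2) (block_complex r) = 2 * r"
proof -
  let ?S = "SIGMA (p, I):moment_angle_index (2 * r + 2). betti_index r p I"
  let ?A = "{((-1 :: int, {} :: nat set), 0 :: nat)}"
  let ?B = "(\<lambda>i. ((2 * int r - 2, missing_face r i), 0 :: nat)) ` {1..r}"
  let ?C = "(\<lambda>i. ((2 * int r - 1, vertices r), i)) ` {1..<r}"
  have V: "{1..2 * r + 2} = vertices r" by (simp add: vertices_def)
  have mf: "missing_face r i \<subseteq> vertices r" for i by (auto simp: missing_face_def)
  have mem: "((p, I), t) \<in> ?S \<longleftrightarrow> I \<subseteq> vertices r \<and> t \<in> betti_index r p I" for p I t
    unfolding moment_angle_index_def V by simp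
  have S: "?S = ?A \<union> ?B \<union> ?C"
  proof (rule Set.set_eqI)
    fix x :: "(int \<times> nat set) \<times> nat"
    obtain p I t where x: "x = ((p, I), t)" by (metis surj_pair)
    show "x \<in> ?S \<longleftrightarrow> x \<in> ?A \<union> ?B \<union> ?C"
      unfolding x mem betti_index_iff using mf by auto
  qed
  have inj: "inj_on (\<lambda>i. ((2 * int r - 2, missing_face r i), 0 :: nat)) {1..r}"
    by (auto simp: inj_on_def missing_face_inj)
  have "card ?S = card ?A + card ?B + card ?C"
  proof -
    have "card (?A \<union> ?B) = card ?A + card ?B"
      by (rule card_Un_disjoint) (use r in auto)
    moreover have "card (?A \<union> ?B \<union> ?C) = card (?A \<union> ?B) + card ?C"
      by (rule card_Un_disjoint) (use r in auto)
    ultimately show ?thesis unfolding S by linarith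
  qed
  also have "\<dots> = 2 * r"
    using r card_image[OF inj] by (simp add: card_image inj_on_def)
  finally have card: "card ?S = 2 * r" .
  have "rank_double_cohomology (2 * r + 2) (block_complex r) = card ?S"
  proof (rule rank_double_cohomology_sparse[OF simplicial_block_complex])
    show "finite ?S" unfolding S by simp
    show "\<exists>\<Phi>. coordinates (reduced_cohomology (full_subcomplex (block_complex r) I) p) (betti_index r p I) \<Phi>"
      if "I \<subseteq> {1..2 * r + 2}" for p I
      using coordinates_full_subcomplex[OF r] that V by simp
    show "betti_index r p I = {} \<or> betti_index r p (I - {i}) = {}"
      if i: "i \<in> I" and I: "I \<subseteq> {1..2 * r + 2}" for p i I
    proof (rule ccontr)
      assume "\<not> ?thesis"
      then have ne: "betti_index r p I \<noteq> {}" "betti_index r p (I - {i}) \<noteq> {}" by auto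
      \<comment> \<open>In each degree, cohomology is concentrated on sets of a single size.\<close>
      have size: "card J = (if p = -1 then 0 else if p = 2 * int r - 2 then 2 * r else 2 * r + 2)"
        if J: "betti_index r p J \<noteq> {}" for J
      proof -
        obtain t where "t \<in> betti_index r p J" using J by blast
        then show ?thesis
          unfolding betti_index_iff using r by (auto simp: card_missing_face vertices_facts)
      qed
      have "finite I" using I by (rule finite_subset) simp
      then have "card (I - {i}) < card I" using i by (metis card_Diff1_less)
      then show False using size[OF ne(1)] size[OF ne(2)] by simp
    qed
  qed
  then show ?thesis using card by simp
qed

theorem theorem2:
  shows "\<exists>(m :: nat \<Rightarrow> nat) (K :: nat \<Rightarrow> nat set set).
    \<forall>r\<ge>1. simplicial_complex_on (m (2 * r)) (K (2 * r)) \<and>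
      rank_double_cohomology (m (2 * r)) (K (2 * r)) = 2 * r"
proof (intro exI allI impI conjI)
  \<comment> \<open>The family is indexed by \<open>n = 2 * r\<close>, with \<open>m n = n + 2\<close> and \<open>K n\<close> the block complex for \<open>n div 2\<close>.\<close>
  fix r :: nat assume "r \<ge> 1"
  then show "rank_double_cohomology (2 * r + 2) (block_complex (2 * r div 2)) = 2 * r"
    using rank_block_complex[of r] by simp
  show "simplicial_complex_on (2 * r + 2) (block_complex (2 * r div 2))"
    using simplicial_block_complex[of r] by simp
qed

end
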